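(* Let $\mathcal E,\mathcal G$ be Hilbert spaces and let $F:[B(\mathcal H)^n]_1\to B(\mathcal H)\bar\otimes_{min}B(\mathcal E,\mathcal G)$ be a bounded free holomorphic function with $\|F\|_\infty=1$. Then the following statements are equivalent. (i) $F$ has the radial infimum property. (ii) $\lim_{r\to1}\inf_{\|x\|=1}\|F(rS_1,\dots,rS_n)x\|=1$. (iii) For every $\epsilon\in(0,1)$ there is $\delta\in(0,1)$ such that $$F(rS_1,\dots,rS_n)^*F(rS_1,\dots,rS_n)\ge(1-\epsilon)I\quad\text{for any } r\in(\delta,1).$$ (iv) There exist constants $c(r)\in(0,1]$, $r\in(0,1)$, with $\lim_{r\to1}c(r)=1$ such that $$F(rS_1,\dots,rS_n)^*F(rS_1,\dots,rS_n)\ge c(r)I.$$ (v) There is $\delta\in(0,1)$ such that $F(rS_1,\dots,rS_n)^*F(rS_1,\dots,rS_n)$ is invertible for any $r\in(\delta,1)$ and $$\lim_{r\to1}\left\|\left[F(rS_1,\dots,rS_n)^*F(rS_1,\dots,rS_n)\right]^{-1}\right\|=1.$$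
   Context: $\mathcal H$ is a separable infinite dimensional Hilbert space and $n\in\{1,2,\dots\}\cup\{\infty\}$. For $X=(X_1,\dots,X_n)\in B(\mathcal H)^n$, $\|X\|=\|\sum_iX_iX_i^*\|^{1/2}$, and $[B(\mathcal H)^n]_1=\{X:\|X\|<1\}$. $\mathbb F_n^+$ is the unital free semigroup on $g_1,\dots,g_n$; for $\alpha=g_{i_1}\cdots g_{i_k}$ put $|\alpha|=k$, $X_\alpha=X_{i_1}\cdots X_{i_k}$ ($X_\alpha=I$ for the neutral element, of length $0$). A free holomorphic function on $[B(\mathcal H)^n]_1$ with coefficients in $B(\mathcal E,\mathcal G)$ is a map $F(X)=\sum_{k=0}^\infty\sum_{|\alpha|=k}X_\alpha\otimes A_{(\alpha)}$ with $A_{(\alpha)}\in B(\mathcal E,\mathcal G)$, the series in $k$ converging in operator norm for all $X\in[B(\mathcal H)^n]_1$ ($\bar\otimes_{min}$ is the spatial tensor product). The same series evaluates $F$ at strict row contractions on any Hilbert space. $\|F\|_\infty=\sup_{\|X\|<1}\|F(X)\|$; $F$ is bounded if this is finite. $F^2(H_n)=\mathbb C1\oplus\bigoplus_{k\ge1}H_n^{\otimes k}$ is the full Fock space of an $n$-dimensional Hilbert space with orthonormal basis $e_1,\dots,e_n$; $S_i\varphi=e_i\otimes\varphi$ are the left creation operators on it. Vectors $x$ above range over $F^2(H_n)\otimes\mathcal E$. $F$ has the radial infimum property if $\liminf_{r\to1}\inf_{\|x\|=1}\|F(rS_1,\dots,rS_n)x\|=\|F\|_\infty$.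
   Formalization: In (iv) the inequality F(rS)^*F(rS) ≥ c(r)I is required only for r sufficiently close to 1, since for all r in (0,1) the claim fails: n=1, F(z)=(z-a)/(1-az), 0<a<1, satisfies (i) but F(aS) is not bounded below. *)

theory Defs
  imports "HOL-Analysis.Analysis"
begin

section \<open>Complex Hilbert spaces\<close>

text \<open>
  The norm, metric and topology are those of the underlying real Hilbert space, whose real inner
  product is the real part of the complex one. The complex inner product is linear in its first
  argument.
\<close>

class chilbert_space = real_inner + complete_space +
  fixes scaleC :: "complex \<Rightarrow> 'a \<Rightarrow> 'a" (infixr \<open>*\<^sub>C\<close> 75)
    and cinner :: "'a \<Rightarrow> 'a \<Rightarrow> complex"
  assumes scaleC_add_right: "c *\<^sub>C (x + y) = c *\<^sub>C x + c *\<^sub>C y"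
    and scaleC_add_left: "(c + d) *\<^sub>C x = c *\<^sub>C x + d *\<^sub>C x"
    and scaleC_scaleC: "c *\<^sub>C d *\<^sub>C x = (c * d) *\<^sub>C x"
    and scaleC_of_real: "complex_of_real r *\<^sub>C x = r *\<^sub>R x"
    and cinner_commute: "cinner x y = cnj (cinner y x)"
    and cinner_add_left: "cinner (x + y) z = cinner x z + cinner y z"
    and cinner_scaleC_left: "cinner (c *\<^sub>C x) y = c * cinner x y"
    and Re_cinner: "Re (cinner x y) = inner x y"
begin

subclass banach ..

end

lemma scaleC_zero_right [simp]: "c *\<^sub>C (0::'a::chilbert_space) = 0"
  using scaleC_add_right[of c 0 "0::'a"] by simp

lemma scaleC_zero_left [simp]: "0 *\<^sub>C (x::'a::chilbert_space) = 0"
  using scaleC_of_real[of 0 x] by simp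

lemma scaleC_one [simp]: "1 *\<^sub>C (x::'a::chilbert_space) = x"
  using scaleC_of_real[of 1 x] by simp

lemma scaleC_minus_right: "c *\<^sub>C (- x) = - (c *\<^sub>C (x::'a::chilbert_space))"
  by (metis add.right_inverse add_eq_0_iff scaleC_add_right scaleC_zero_right)

lemma scaleC_diff_right: "c *\<^sub>C (x - y) = c *\<^sub>C x - c *\<^sub>C (y::'a::chilbert_space)"
  by (metis add_uminus_conv_diff scaleC_add_right scaleC_minus_right)

lemma scaleC_scaleR: "c *\<^sub>C (r *\<^sub>R x) = r *\<^sub>R (c *\<^sub>C (x::'a::chilbert_space))"
  by (metis mult.commute scaleC_of_real scaleC_scaleC)

lemma cinner_add_right: "cinner x (y + z) = cinner x y + cinner x (z::'a::chilbert_space)"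
  by (metis cinner_add_left cinner_commute complex_cnj_add)

lemma cinner_scaleC_right: "cinner x (c *\<^sub>C y) = cnj c * cinner x (y::'a::chilbert_space)"
  by (metis cinner_commute cinner_scaleC_left complex_cnj_mult)

lemma cinner_zero_left [simp]: "cinner 0 (x::'a::chilbert_space) = 0"
  using cinner_add_left[of 0 0 x] by simp

lemma cinner_zero_right [simp]: "cinner (x::'a::chilbert_space) 0 = 0"
  using cinner_add_right[of x 0 0] by simp

lemma cinner_diff_left: "cinner (x - y) z = cinner x z - cinner y (z::'a::chilbert_space)"
  using cinner_add_left[of "x - y" y z] by simp

lemma cinner_diff_right: "cinner z (x - y) = cinner z x - cinner z (y::'a::chilbert_space)"
  using cinner_add_right[of z "x - y" y] by simp

lemma cinner_self: "cinner x x = complex_of_real ((norm (x::'a::chilbert_space))\<^sup>2)"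
proof -
  have "Im (cinner x x) = 0"
    by (metis add.inverse_neutral cinner_commute complex_cnj_cancel_iff complex_cnj_complex_of_real
        complex_is_Real_iff Reals_cnj_iff)
  then show ?thesis
    by (auto simp: complex_eq_iff Re_cinner power2_norm_eq_inner)
qed

lemma norm_scaleC: "norm (c *\<^sub>C (x::'a::chilbert_space)) = cmod c * norm x"
proof -
  have "cinner (c *\<^sub>C x) (c *\<^sub>C x) = (c * cnj c) * cinner x x"
    by (simp add: cinner_scaleC_left cinner_scaleC_right)
  also have "\<dots> = complex_of_real ((cmod c * norm x)\<^sup>2)"
    by (simp add: cinner_self complex_norm_square[symmetric] power_mult_distrib)
  finally have "complex_of_real ((norm (c *\<^sub>C x))\<^sup>2) = complex_of_real ((cmod c * norm x)\<^sup>2)"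
    by (simp only: cinner_self)
  then have "(norm (c *\<^sub>C x))\<^sup>2 = (cmod c * norm x)\<^sup>2"
    by (simp only: of_real_eq_iff)
  then show ?thesis by simp
qed

lemma cinner_norm_le: "cmod (cinner x y) \<le> norm x * norm (y::'a::chilbert_space)"
proof (cases "cinner x y = 0")
  case False
  define c where "c = cnj (cinner x y) / complex_of_real (cmod (cinner x y))"
  have c: "cmod c = 1" using False by (simp add: c_def norm_divide)
  have "cnj (cinner x y) * cinner x y =
      complex_of_real (cmod (cinner x y)) * complex_of_real (cmod (cinner x y))"
    using complex_norm_square[of "cinner x y"] by (simp add: power2_eq_square mult.commute)
  then have "c * cinner x y = complex_of_real (cmod (cinner x y))"
    using False unfolding c_def times_divide_eq_left by simp
  then have "cmod (cinner x y) = Re (cinner (c *\<^sub>C x) y)"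
    by (simp add: cinner_scaleC_left)
  also have "\<dots> = inner (c *\<^sub>C x) y" by (rule Re_cinner)
  also have "\<dots> \<le> norm (c *\<^sub>C x) * norm y" by (rule norm_cauchy_schwarz)
  finally show ?thesis by (simp add: norm_scaleC c)
qed simp

lemma bounded_linear_cinner_left: "bounded_linear (\<lambda>x. cinner x (y::'a::chilbert_space))"
  by (rule bounded_linear_intro[where K = "norm y"])
    (auto simp: cinner_add_left cinner_norm_le cinner_scaleC_left scaleR_conv_of_real
      simp flip: scaleC_of_real)

instantiation complex :: chilbert_space
begin
definition "c *\<^sub>C (z::complex) = c * z"
definition "cinner (z::complex) w = z * cnj w"
instance
  by standard (auto simp: scaleC_complex_def cinner_complex_def algebra_simps scaleR_conv_of_real
      inner_complex_def)
end

section \<open>Hilbert space valued square summable families\<close>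

typedef (overloaded) ('i, 'a) ell2 =
  "{f :: 'i \<Rightarrow> 'a::chilbert_space. (\<lambda>i. (norm (f i))\<^sup>2) summable_on UNIV}"
  morphisms ell2_fun Abs_ell2
  by (rule exI[of _ "\<lambda>_. 0"]) simp

lemma ell2_summable: "(\<lambda>i. (norm (ell2_fun f i))\<^sup>2) summable_on UNIV"
  using ell2_fun[of f] by simp

lemma ell2_funI: "(\<lambda>i. (norm (f i))\<^sup>2) summable_on UNIV \<Longrightarrow> ell2_fun (Abs_ell2 f) = f"
  by (simp add: Abs_ell2_inverse)

lemma ell2_eqI: "(\<And>i. ell2_fun f i = ell2_fun g i) \<Longrightarrow> f = g"
  by (simp add: ell2_fun_inject[symmetric] ext)

lemma sq_summable_add:
  fixes f g :: "'i \<Rightarrow> 'a::chilbert_space"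
  assumes "(\<lambda>i. (norm (f i))\<^sup>2) summable_on UNIV" "(\<lambda>i. (norm (g i))\<^sup>2) summable_on UNIV"
  shows "(\<lambda>i. (norm (f i + g i))\<^sup>2) summable_on UNIV"
proof (rule summable_on_comparison_test)
  show "(\<lambda>i. 2 * (norm (f i))\<^sup>2 + 2 * (norm (g i))\<^sup>2) summable_on UNIV"
    by (intro summable_on_add summable_on_cmult_right assms)
  show "(norm (f i + g i))\<^sup>2 \<le> 2 * (norm (f i))\<^sup>2 + 2 * (norm (g i))\<^sup>2" for i
  proof -
    have "(norm (f i + g i))\<^sup>2 \<le> (norm (f i) + norm (g i))\<^sup>2"
      by (intro power_mono norm_triangle_ineq) auto
    also have "\<dots> \<le> 2 * (norm (f i))\<^sup>2 + 2 * (norm (g i))\<^sup>2"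
      using sum_squares_bound[of "norm (f i)" "norm (g i)"] by (simp add: power2_sum)
    finally show ?thesis .
  qed
qed auto

lemma sq_summable_scaleC:
  fixes f :: "'i \<Rightarrow> 'a::chilbert_space"
  assumes "(\<lambda>i. (norm (f i))\<^sup>2) summable_on UNIV"
  shows "(\<lambda>i. (norm (c *\<^sub>C f i))\<^sup>2) summable_on UNIV"
  by (simp add: norm_scaleC power_mult_distrib summable_on_cmult_right assms)

lemma abs_summable_cinner:
  fixes f g :: "'i \<Rightarrow> 'a::chilbert_space"
  assumes "(\<lambda>i. (norm (f i))\<^sup>2) summable_on UNIV" "(\<lambda>i. (norm (g i))\<^sup>2) summable_on UNIV"
  shows "(\<lambda>i. cinner (f i) (g i)) summable_on UNIV"
proof -
  have "(\<lambda>i. norm (cinner (f i) (g i))) summable_on UNIV"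
  proof (rule summable_on_comparison_test)
    show "(\<lambda>i. (norm (f i))\<^sup>2 + (norm (g i))\<^sup>2) summable_on UNIV"
      by (intro summable_on_add assms)
    show "norm (cinner (f i) (g i)) \<le> (norm (f i))\<^sup>2 + (norm (g i))\<^sup>2" for i
      using cinner_norm_le[of "f i" "g i"] sum_squares_bound[of "norm (f i)" "norm (g i)"]
        zero_le_mult_iff[of "norm (f i)" "norm (g i)"] norm_ge_zero[of "f i"] norm_ge_zero[of "g i"]
      by linarith
  qed auto
  then show ?thesis by (rule abs_summable_summable)
qed

lemmas ell2_cinner_summable = abs_summable_cinner[OF ell2_summable ell2_summable]

lemma ell2_inner_summable: "(\<lambda>i. inner (ell2_fun f i) (ell2_fun g i)) summable_on UNIV"
  using summable_on_Re[OF ell2_cinner_summable] by (simp add: Re_cinner)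

instantiation ell2 :: (type, chilbert_space) real_inner
begin

definition "0 = Abs_ell2 (\<lambda>_. 0)"
definition "f + g = Abs_ell2 (\<lambda>i. ell2_fun f i + ell2_fun g i)"
definition "r *\<^sub>R f = Abs_ell2 (\<lambda>i. r *\<^sub>R ell2_fun f i)"
definition "- (f::('a,'b) ell2) = (- 1) *\<^sub>R f"
definition "f - (g::('a,'b) ell2) = f + (- g)"
definition "inner f g = (\<Sum>\<^sub>\<infinity>i. inner (ell2_fun f i) (ell2_fun g i))"
definition "norm (f::('a,'b) ell2) = sqrt (inner f f)"
definition "sgn (f::('a,'b) ell2) = inverse (norm f) *\<^sub>R f"
definition "dist f (g::('a,'b) ell2) = norm (f - g)"
definition "(uniformity :: (('a,'b) ell2 \<times> ('a,'b) ell2) filter) =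
  (INF e\<in>{0 <..}. principal {(x, y). dist x y < e})"
definition "open (U::('a,'b) ell2 set) \<longleftrightarrow>
  (\<forall>x\<in>U. \<forall>\<^sub>F (x', y) in uniformity. x' = x \<longrightarrow> y \<in> U)"

lemma ell2_fun_zero: "ell2_fun (0::('a,'b) ell2) i = 0"
  by (simp add: zero_ell2_def ell2_funI)

lemma ell2_fun_add: "ell2_fun (f + g :: ('a,'b) ell2) i = ell2_fun f i + ell2_fun g i"
  by (simp add: plus_ell2_def ell2_funI sq_summable_add ell2_summable)

lemma ell2_fun_scaleR: "ell2_fun (r *\<^sub>R f :: ('a,'b) ell2) i = r *\<^sub>R ell2_fun f i"
  using sq_summable_scaleC[OF ell2_summable, of "complex_of_real r" f]
  by (simp add: scaleR_ell2_def ell2_funI scaleC_of_real)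

lemma ell2_fun_minus: "ell2_fun (- f :: ('a,'b) ell2) i = - ell2_fun f i"
  by (simp add: uminus_ell2_def ell2_fun_scaleR)

lemma ell2_fun_diff: "ell2_fun (f - g :: ('a,'b) ell2) i = ell2_fun f i - ell2_fun g i"
  by (simp add: minus_ell2_def ell2_fun_add ell2_fun_minus)

lemma ell2_inner_self: "inner f (f::('a,'b) ell2) = (\<Sum>\<^sub>\<infinity>i. (norm (ell2_fun f i))\<^sup>2)"
  by (simp add: inner_ell2_def power2_norm_eq_inner)

instance
proof
  fix f g h :: "('a,'b) ell2" and r s :: real
  show "f + g + h = f + (g + h)" "f + g = g + f"
    by (auto intro!: ell2_eqI simp: ell2_fun_add add_ac)
  show "0 + f = f" by (auto intro!: ell2_eqI simp: ell2_fun_add ell2_fun_zero)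
  show "- f + f = 0" by (auto intro!: ell2_eqI simp: ell2_fun_add ell2_fun_zero ell2_fun_minus)
  show "f - g = f + - g" by (simp add: minus_ell2_def)
  show "r *\<^sub>R (f + g) = r *\<^sub>R f + r *\<^sub>R g" "(r + s) *\<^sub>R f = r *\<^sub>R f + s *\<^sub>R f"
    "r *\<^sub>R s *\<^sub>R f = (r * s) *\<^sub>R f" "1 *\<^sub>R f = f"
    by (auto intro!: ell2_eqI simp: ell2_fun_add ell2_fun_scaleR scaleR_add_left scaleR_add_right)
  show "inner f g = inner g f" by (simp add: inner_ell2_def inner_commute)
  show "inner (f + g) h = inner f h + inner g h"
    unfolding inner_ell2_def ell2_fun_add inner_add_left
    by (rule infsum_add) (rule ell2_inner_summable)+
  show "inner (r *\<^sub>R f) g = r * inner f g"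
    unfolding inner_ell2_def ell2_fun_scaleR inner_scaleR_left
    by (rule infsum_cmult_right) (rule ell2_inner_summable)
  show "0 \<le> inner f f" by (simp add: ell2_inner_self infsum_nonneg)
  show "inner f f = 0 \<longleftrightarrow> f = 0"
  proof
    assume *: "inner f f = 0"
    show "f = 0"
    proof (rule ell2_eqI)
      fix i
      have "(norm (ell2_fun f i))\<^sup>2 = 0"
        by (rule nonneg_infsum_le_0D[OF _ ell2_summable])
          (use * in \<open>auto simp: ell2_inner_self\<close>)
      then show "ell2_fun f i = ell2_fun 0 i" by (simp add: ell2_fun_zero)
    qed
  next
    assume "f = 0" then show "inner f f = 0" by (simp add: ell2_inner_self ell2_fun_zero)
  qed
  show "norm f = sqrt (inner f f)" by (rule norm_ell2_def)
  show "sgn f = inverse (norm f) *\<^sub>R f" by (rule sgn_ell2_def)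
  show "dist f g = norm (f - g)" by (rule dist_ell2_def)
  show "(uniformity :: (('a,'b) ell2 \<times> ('a,'b) ell2) filter) =
    (INF e\<in>{0 <..}. principal {(x, y). dist x y < e})" by (rule uniformity_ell2_def)
  show "open U = (\<forall>x\<in>U. \<forall>\<^sub>F (x', y) in uniformity. x' = x \<longrightarrow> y \<in> U)" for U :: "('a,'b) ell2 set"
    by (rule open_ell2_def)
qed

end

lemma ell2_norm_sq: "(norm f)\<^sup>2 = (\<Sum>\<^sub>\<infinity>i. (norm (ell2_fun f i))\<^sup>2)"
  by (simp add: power2_norm_eq_inner ell2_inner_self)

lemma ell2_finite_sum_le: "finite A \<Longrightarrow> (\<Sum>i\<in>A. (norm (ell2_fun f i))\<^sup>2) \<le> (norm f)\<^sup>2"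
  unfolding ell2_norm_sq by (rule finite_sum_le_infsum) (auto intro: ell2_summable)

lemma ell2_norm_leI:
  assumes "0 \<le> e" "\<And>A. finite A \<Longrightarrow> (\<Sum>i\<in>A. (norm (ell2_fun f i))\<^sup>2) \<le> e\<^sup>2"
  shows "norm f \<le> e"
proof -
  have "(norm f)\<^sup>2 \<le> e\<^sup>2"
    unfolding ell2_norm_sq by (rule infsum_le_finite_sums[OF ell2_summable]) (use assms in auto)
  then show ?thesis using assms(1) by (rule power2_le_imp_le)
qed

lemma ell2_component_le: "norm (ell2_fun f i) \<le> norm f"
  using ell2_finite_sum_le[of "{i}" f] by (auto intro: power2_le_imp_le)

instantiation ell2 :: (type, chilbert_space) chilbert_space
begin

definition "c *\<^sub>C f = Abs_ell2 (\<lambda>i. c *\<^sub>C ell2_fun f i)"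
definition "cinner f g = (\<Sum>\<^sub>\<infinity>i. cinner (ell2_fun f i) (ell2_fun g i))"

lemma ell2_fun_scaleC: "ell2_fun (c *\<^sub>C f :: ('a,'b) ell2) i = c *\<^sub>C ell2_fun f i"
  by (simp add: scaleC_ell2_def ell2_funI sq_summable_scaleC ell2_summable)

instance
proof
  fix f g h :: "('a,'b) ell2" and r :: real and c d :: complex
  show "c *\<^sub>C (f + g) = c *\<^sub>C f + c *\<^sub>C g" "(c + d) *\<^sub>C f = c *\<^sub>C f + d *\<^sub>C f"
    "c *\<^sub>C d *\<^sub>C f = (c * d) *\<^sub>C f" "complex_of_real r *\<^sub>C f = r *\<^sub>R f"
    by (auto intro!: ell2_eqI simp: ell2_fun_add ell2_fun_scaleR ell2_fun_scaleC
        scaleC_add_left scaleC_add_right scaleC_scaleC scaleC_of_real)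
  show "cinner f g = cnj (cinner g f)"
    unfolding cinner_ell2_def infsum_cnj[symmetric] by (subst cinner_commute) simp
  show "cinner (f + g) h = cinner f h + cinner g h"
    unfolding cinner_ell2_def ell2_fun_add cinner_add_left
    by (rule infsum_add) (rule ell2_cinner_summable)+
  show "cinner (c *\<^sub>C f) g = c * cinner f g"
    unfolding cinner_ell2_def ell2_fun_scaleC cinner_scaleC_left
    by (rule infsum_cmult_right) (rule ell2_cinner_summable)
  show "Re (cinner f g) = inner f g"
    unfolding cinner_ell2_def inner_ell2_def
    by (subst infsum_Re[symmetric]) (auto simp: ell2_cinner_summable Re_cinner)
next
  fix X :: "nat \<Rightarrow> ('a,'b) ell2"
  assume X: "Cauchy X"
  have "Cauchy (\<lambda>n. ell2_fun (X n) i)" for i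
  proof (rule metric_CauchyI)
    fix e :: real assume "0 < e"
    then obtain M where M: "\<And>m n. m \<ge> M \<Longrightarrow> n \<ge> M \<Longrightarrow> dist (X m) (X n) < e"
      using metric_CauchyD[OF X \<open>0 < e\<close>] by blast
    have "dist (ell2_fun (X m) i) (ell2_fun (X n) i) < e" if "m \<ge> M" "n \<ge> M" for m n
      using M[OF that] ell2_component_le[of "X m - X n" i] by (simp add: dist_norm ell2_fun_diff)
    then show "\<exists>M. \<forall>m\<ge>M. \<forall>n\<ge>M. dist (ell2_fun (X m) i) (ell2_fun (X n) i) < e" by blast
  qed
  then obtain g where g: "\<And>i. (\<lambda>n. ell2_fun (X n) i) \<longlonglongrightarrow> g i"
    unfolding Cauchy_convergent_iff convergent_def by metis
  have tail: "(\<Sum>i\<in>A. (norm (ell2_fun (X m) i - g i))\<^sup>2) \<le> e\<^sup>2"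
    if "finite A" "m \<ge> M" "\<And>m n. m \<ge> M \<Longrightarrow> n \<ge> M \<Longrightarrow> dist (X m) (X n) < e"
    for A :: "'a set" and m M e
  proof (rule LIMSEQ_le_const2)
    show "(\<lambda>n. \<Sum>i\<in>A. (norm (ell2_fun (X m) i - ell2_fun (X n) i))\<^sup>2) \<longlonglongrightarrow>
        (\<Sum>i\<in>A. (norm (ell2_fun (X m) i - g i))\<^sup>2)"
      by (intro tendsto_intros g)
    have "(\<Sum>i\<in>A. (norm (ell2_fun (X m) i - ell2_fun (X n) i))\<^sup>2) \<le> e\<^sup>2" if "n \<ge> M" for n
    proof -
      have "(norm (X m - X n))\<^sup>2 \<le> e\<^sup>2"
        using \<open>m \<ge> M\<close> that \<open>\<And>m n. m \<ge> M \<Longrightarrow> n \<ge> M \<Longrightarrow> dist (X m) (X n) < e\<close>[of m n]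
        by (intro power_mono) (auto simp: dist_norm)
      then show ?thesis
        using ell2_finite_sum_le[OF \<open>finite A\<close>, of "X m - X n"] by (simp add: ell2_fun_diff)
    qed
    then show "\<exists>N. \<forall>n\<ge>N. (\<Sum>i\<in>A. (norm (ell2_fun (X m) i - ell2_fun (X n) i))\<^sup>2) \<le> e\<^sup>2"
      by blast
  qed
  obtain M where M: "\<And>m n. m \<ge> M \<Longrightarrow> n \<ge> M \<Longrightarrow> dist (X m) (X n) < 1"
    using X unfolding Cauchy_def by (meson zero_less_one)
  have "(\<lambda>i. (norm (ell2_fun (X M) i - g i))\<^sup>2) summable_on UNIV"
    by (rule nonneg_bdd_above_summable_on) (auto intro!: bdd_aboveI2 tail[OF _ order.refl M])
  from sq_summable_add[OF sq_summable_scaleC[OF this, of "- 1"] ell2_summable[of "X M"]]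
  have "(\<lambda>i. (norm (g i))\<^sup>2) summable_on UNIV"
    using scaleC_of_real[of "- 1", where 'a = 'b] by simp
  then have h: "ell2_fun (Abs_ell2 g) = g" by (rule ell2_funI)
  have "X \<longlonglongrightarrow> Abs_ell2 g"
  proof (rule metric_LIMSEQ_I)
    fix e :: real assume "0 < e"
    then obtain M where M: "\<And>m n. m \<ge> M \<Longrightarrow> n \<ge> M \<Longrightarrow> dist (X m) (X n) < e / 2"
      using metric_CauchyD[OF X half_gt_zero[OF \<open>0 < e\<close>]] by blast
    have "norm (X m - Abs_ell2 g) \<le> e / 2" if "m \<ge> M" for m
      using \<open>0 < e\<close> tail[OF _ that M] by (intro ell2_norm_leI) (auto simp: ell2_fun_diff h)
    then show "\<exists>M. \<forall>m\<ge>M. dist (X m) (Abs_ell2 g) < e"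
      using \<open>0 < e\<close> by (intro exI[of _ M]) (force simp: dist_norm)
  qed
  then show "convergent X" by (auto simp: convergent_def)
qed

end

section \<open>Orthonormal bases\<close>

definition orthonormal :: "'a::chilbert_space set \<Rightarrow> bool" where
  "orthonormal B \<longleftrightarrow> (\<forall>a\<in>B. \<forall>b\<in>B. cinner a b = (if a = b then 1 else 0))"

definition is_onb :: "'a::chilbert_space set \<Rightarrow> bool" where
  "is_onb B \<longleftrightarrow> orthonormal B \<and> (\<forall>x. (\<forall>b\<in>B. cinner x b = 0) \<longrightarrow> x = 0)"

lemma is_onb_exists: "\<exists>B::'a::chilbert_space set. is_onb B"
proof -
  have "\<exists>M\<in>Collect orthonormal. \<forall>X\<in>Collect orthonormal. M \<subseteq> X \<longrightarrow> X = (M::'a set)"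
  proof (rule subset_Zorn')
    fix C :: "'a set set"
    assume C: "subset.chain (Collect orthonormal) C"
    have "cinner a b = (if a = b then 1 else 0)" if ab: "a \<in> \<Union>C" "b \<in> \<Union>C" for a b
    proof -
      obtain A B where AB: "A \<in> C" "a \<in> A" "B \<in> C" "b \<in> B" using ab by auto
      then have "A \<subseteq> B \<or> B \<subseteq> A" using C by (auto simp: subset_chain_def)
      then have "\<exists>D\<in>C. a \<in> D \<and> b \<in> D" using AB by blast
      then show ?thesis using C unfolding subset_chain_def orthonormal_def by blast
    qed
    then show "\<Union>C \<in> Collect orthonormal" by (auto simp: orthonormal_def)
  qed
  then obtain M :: "'a set" where M: "orthonormal M"
    and max: "\<And>X. orthonormal X \<Longrightarrow> M \<subseteq> X \<Longrightarrow> X = M" by auto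
  have "x = 0" if x: "\<forall>b\<in>M. cinner x b = 0" for x
  proof (rule ccontr)
    assume "x \<noteq> 0"
    define u where "u = complex_of_real (inverse (norm x)) *\<^sub>C x"
    have u: "cinner u u = 1"
      using \<open>x \<noteq> 0\<close> by (simp add: u_def cinner_self norm_scaleC flip: of_real_inverse)
    have ub: "cinner u b = 0" "cinner b u = 0" if "b \<in> M" for b
      using x that cinner_commute[of b u] by (simp_all add: u_def cinner_scaleC_left)
    have "orthonormal (insert u M)"
      using M u ub unfolding orthonormal_def by (metis insert_iff zero_neq_one)
    with max have "u \<in> M" by blast
    then show False using u ub by auto
  qed
  with M show ?thesis by (auto simp: is_onb_def)
qed

definition onb :: "'a::chilbert_space set" where
  "onb = (SOME B. is_onb B)"

lemma is_onb_onb: "is_onb onb"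
  unfolding onb_def by (rule someI_ex) (rule is_onb_exists)

lemma cinner_sum_left: "cinner (\<Sum>a\<in>A. f a) y = (\<Sum>a\<in>A. cinner (f a) (y::'a::chilbert_space))"
  by (rule linear_sum[OF bounded_linear.linear[OF bounded_linear_cinner_left]])

lemma orthonormal_sum_cinner:
  assumes "orthonormal B" "finite A" "A \<subseteq> B" "b \<in> B"
  shows "cinner (\<Sum>a\<in>A. c a *\<^sub>C a) b = (if b \<in> A then c b else 0)"
proof -
  have "cinner (\<Sum>a\<in>A. c a *\<^sub>C a) b = (\<Sum>a\<in>A. if a = b then c a else 0)"
    unfolding cinner_sum_left cinner_scaleC_left
    by (rule sum.cong) (use assms in \<open>auto simp: orthonormal_def\<close>)
  then show ?thesis using assms(2) by simp
qed

lemma orthonormal_sum_norm: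
  assumes "orthonormal B" "finite A" "A \<subseteq> B"
  shows "(norm (\<Sum>a\<in>A. c a *\<^sub>C a))\<^sup>2 = (\<Sum>a\<in>A. (cmod (c a))\<^sup>2)"
proof -
  let ?p = "\<Sum>a\<in>A. c a *\<^sub>C a"
  have "cinner ?p ?p = (\<Sum>a\<in>A. c a * cnj (cinner ?p a))"
    by (subst (1) cinner_sum_left) (simp add: cinner_scaleC_left flip: cinner_commute)
  also have "\<dots> = (\<Sum>a\<in>A. complex_of_real ((cmod (c a))\<^sup>2))"
  proof (rule sum.cong)
    fix a assume "a \<in> A"
    then have "cinner ?p a = c a" using orthonormal_sum_cinner[OF assms, of a c] assms by auto
    then show "c a * cnj (cinner ?p a) = complex_of_real ((cmod (c a))\<^sup>2)"
      by (simp add: complex_norm_square del: of_real_power)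
  qed simp
  finally show ?thesis unfolding cinner_self of_real_sum[symmetric] of_real_eq_iff .
qed

lemma bessel:
  assumes "orthonormal B" "finite A" "A \<subseteq> B"
  shows "(\<Sum>a\<in>A. (cmod (cinner x a))\<^sup>2) \<le> (norm x)\<^sup>2"
proof -
  let ?p = "\<Sum>a\<in>A. cinner x a *\<^sub>C a"
  have "cinner ?p x = (\<Sum>a\<in>A. complex_of_real ((cmod (cinner x a))\<^sup>2))"
    unfolding cinner_sum_left cinner_scaleC_left
    by (rule sum.cong) (auto simp: complex_norm_square cinner_commute[of _ x] simp del: of_real_power)
  then have "Re (cinner ?p x) = (\<Sum>a\<in>A. (cmod (cinner x a))\<^sup>2)" by simp
  then have "inner ?p x = (\<Sum>a\<in>A. (cmod (cinner x a))\<^sup>2)" by (simp only: Re_cinner)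
  moreover have "inner ?p ?p = (\<Sum>a\<in>A. (cmod (cinner x a))\<^sup>2)"
    using orthonormal_sum_norm[OF assms] by (simp add: power2_norm_eq_inner)
  moreover have "0 \<le> inner (x - ?p) (x - ?p)" by simp
  ultimately show ?thesis
    by (simp add: inner_diff_left inner_diff_right inner_commute power2_norm_eq_inner)
qed

lemma bessel_summable:
  "orthonormal B \<Longrightarrow> (\<lambda>a. (cmod (cinner x a))\<^sup>2) summable_on B"
  by (rule nonneg_bdd_above_summable_on) (auto intro!: bdd_aboveI2 bessel)

lemma onb_expansion:
  assumes "is_onb B"
  shows "((\<lambda>a. cinner x a *\<^sub>C a) has_sum x) B"
proof -
  have B: "orthonormal B" using assms by (simp add: is_onb_def)
  let ?f = "\<lambda>a. cinner x a *\<^sub>C a" and ?q = "\<lambda>a. (cmod (cinner x a))\<^sup>2"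
  obtain L where L: "(sum ?q \<longlongrightarrow> L) (finite_subsets_at_top B)"
    using bessel_summable[OF B, of x] by (auto simp: summable_on_def has_sum_def)
  have "\<exists>P. eventually P (finite_subsets_at_top B) \<and>
            (\<forall>F F'. P F \<and> P F' \<longrightarrow> dist (sum ?f F) (sum ?f F') < e)" if "e > 0" for e
  proof -
    have "\<forall>\<^sub>F F in finite_subsets_at_top B. dist (sum ?q F) L < e\<^sup>2 / 8"
      by (rule tendstoD[OF L]) (use that in simp)
    then have "\<exists>F0. finite F0 \<and> F0 \<subseteq> B \<and>
        (\<forall>F. finite F \<and> F0 \<subseteq> F \<and> F \<subseteq> B \<longrightarrow> dist (sum ?q F) L < e\<^sup>2 / 8)"
      by (simp only: eventually_finite_subsets_at_top)
    then obtain F0 where F0: "finite F0" "F0 \<subseteq> B"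
      "\<And>F. finite F \<Longrightarrow> F0 \<subseteq> F \<Longrightarrow> F \<subseteq> B \<Longrightarrow> dist (sum ?q F) L < e\<^sup>2 / 8"
      by (elim exE conjE) simp
    have near: "norm (sum ?f F - sum ?f F0) < e / 2" if F: "finite F" "F0 \<subseteq> F" "F \<subseteq> B" for F
    proof -
      have "sum ?f F - sum ?f F0 = sum ?f (F - F0)" using F by (simp add: sum_diff)
      moreover have "(norm (sum ?f (F - F0)))\<^sup>2 = sum ?q (F - F0)"
        by (rule orthonormal_sum_norm[OF B]) (use F in auto)
      moreover have "sum ?q (F - F0) = sum ?q F - sum ?q F0" using F by (simp add: sum_diff)
      moreover have "sum ?q F - sum ?q F0 < e\<^sup>2 / 4"
        using F0(3)[OF F] F0(3)[OF F0(1) order.refl F0(2)] unfolding dist_real_def by linarith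
      ultimately have "(norm (sum ?f F - sum ?f F0))\<^sup>2 < (e / 2)\<^sup>2"
        by (simp add: power_divide)
      then show ?thesis by (rule power2_less_imp_less) (use \<open>e > 0\<close> in simp)
    qed
    show ?thesis
    proof (intro exI conjI allI impI)
      show "\<forall>\<^sub>F F in finite_subsets_at_top B. finite F \<and> F0 \<subseteq> F \<and> F \<subseteq> B"
        unfolding eventually_finite_subsets_at_top using F0(1,2) by blast
      fix F F' assume "(finite F \<and> F0 \<subseteq> F \<and> F \<subseteq> B) \<and> (finite F' \<and> F0 \<subseteq> F' \<and> F' \<subseteq> B)"
      then have "dist (sum ?f F) (sum ?f F0) < e / 2" "dist (sum ?f F') (sum ?f F0) < e / 2"
        using near by (auto simp: dist_norm)
      then show "dist (sum ?f F) (sum ?f F') < e" by (rule dist_triangle_half_l)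
    qed
  qed
  then have "cauchy_filter (filtermap (sum ?f) (finite_subsets_at_top B))"
    by (simp add: cauchy_filter_metric_filtermap)
  moreover have "complete (UNIV::'a set)"
    by (meson Cauchy_convergent UNIV_I complete_def convergent_def)
  ultimately obtain y where "(sum ?f \<longlongrightarrow> y) (finite_subsets_at_top B)"
    using complete_uniform[where S=UNIV] by (force simp add: filterlim_def)
  then have y: "(?f has_sum y) B" by (simp add: has_sum_def)
  have "cinner (x - y) b = 0" if "b \<in> B" for b
  proof -
    have "((\<lambda>a. cinner (?f a) b) has_sum cinner y b) B"
      by (rule has_sum_bounded_linear[OF bounded_linear_cinner_left y])
    moreover have "((\<lambda>a. cinner (?f a) b) has_sum cinner x b) B"
      by (rule has_sum_finite_neutralI[of "{b}"])
        (use that B in \<open>auto simp: cinner_scaleC_left orthonormal_def\<close>)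
    ultimately show ?thesis by (simp add: cinner_diff_left has_sum_unique)
  qed
  then have "x - y = 0" using assms unfolding is_onb_def by blast
  then show ?thesis using y by simp
qed

section \<open>The Hilbert space tensor product\<close>

text \<open>
  The tensor product of \<open>'a\<close> and \<open>'b\<close> is modelled as the space of square summable families in
  \<open>'b\<close> indexed by an orthonormal basis of \<open>'a\<close>. The lemmas \<open>cinner_tensor\<close> and
  \<open>closure_span_tensor\<close> below characterise it, with its simple tensors, up to a unique unitary,
  independently of the basis.
\<close>

typedef (overloaded) ('a, 'b) htensor =
  "{f :: ('a::chilbert_space, 'b::chilbert_space) ell2. \<forall>a. a \<notin> onb \<longrightarrow> ell2_fun f a = 0}"
  morphisms htensor_ell2 Abs_htensor
  by (rule exI[of _ 0]) (simp add: ell2_fun_zero)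

lemma htensor_ell2_outside: "a \<notin> onb \<Longrightarrow> ell2_fun (htensor_ell2 f) a = 0"
  using htensor_ell2[of f] by simp

lemma htensor_ell2I: "(\<And>a. a \<notin> onb \<Longrightarrow> ell2_fun f a = 0) \<Longrightarrow> htensor_ell2 (Abs_htensor f) = f"
  by (simp add: Abs_htensor_inverse)

instantiation htensor :: (chilbert_space, chilbert_space) real_inner
begin

definition "0 = Abs_htensor 0"
definition "f + g = Abs_htensor (htensor_ell2 f + htensor_ell2 g)"
definition "r *\<^sub>R f = Abs_htensor (r *\<^sub>R htensor_ell2 f)"
definition "- f = Abs_htensor (- htensor_ell2 f)"
definition "f - g = Abs_htensor (htensor_ell2 f - htensor_ell2 g)"
definition "inner f g = inner (htensor_ell2 f) (htensor_ell2 g)"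
definition "norm f = norm (htensor_ell2 f)"
definition "sgn (f::('a,'b) htensor) = inverse (norm f) *\<^sub>R f"
definition "dist f g = dist (htensor_ell2 f) (htensor_ell2 g)"
definition "(uniformity :: (('a,'b) htensor \<times> ('a,'b) htensor) filter) =
  (INF e\<in>{0 <..}. principal {(x, y). dist x y < e})"
definition "open (U::('a,'b) htensor set) \<longleftrightarrow>
  (\<forall>x\<in>U. \<forall>\<^sub>F (x', y) in uniformity. x' = x \<longrightarrow> y \<in> U)"

lemma htensor_ell2_zero: "htensor_ell2 (0::('a,'b) htensor) = 0"
  by (simp add: zero_htensor_def htensor_ell2I ell2_fun_zero)

lemma htensor_ell2_add: "htensor_ell2 (f + g :: ('a,'b) htensor) = htensor_ell2 f + htensor_ell2 g"
  by (simp add: plus_htensor_def htensor_ell2I ell2_fun_add htensor_ell2_outside)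

lemma htensor_ell2_scaleR: "htensor_ell2 (r *\<^sub>R f :: ('a,'b) htensor) = r *\<^sub>R htensor_ell2 f"
  by (simp add: scaleR_htensor_def htensor_ell2I ell2_fun_scaleR htensor_ell2_outside)

lemma htensor_ell2_minus: "htensor_ell2 (- f :: ('a,'b) htensor) = - htensor_ell2 f"
  by (simp add: uminus_htensor_def htensor_ell2I ell2_fun_minus htensor_ell2_outside)

lemma htensor_ell2_diff: "htensor_ell2 (f - g :: ('a,'b) htensor) = htensor_ell2 f - htensor_ell2 g"
  by (simp add: minus_htensor_def htensor_ell2I ell2_fun_diff htensor_ell2_outside)

instance
proof
  fix f g h :: "('a,'b) htensor" and r s :: real
  note simps = htensor_ell2_inject[symmetric] htensor_ell2_zero htensor_ell2_add
    htensor_ell2_scaleR htensor_ell2_minus htensor_ell2_diff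
  show "f + g + h = f + (g + h)" "f + g = g + f" "0 + f = f" "- f + f = 0" "f - g = f + - g"
    "r *\<^sub>R (f + g) = r *\<^sub>R f + r *\<^sub>R g" "(r + s) *\<^sub>R f = r *\<^sub>R f + s *\<^sub>R f"
    "r *\<^sub>R s *\<^sub>R f = (r * s) *\<^sub>R f" "1 *\<^sub>R f = f"
    by (simp_all add: simps add_ac scaleR_add_left scaleR_add_right)
  show "inner f g = inner g f" by (simp add: inner_htensor_def inner_commute)
  show "inner (f + g) h = inner f h + inner g h"
    by (simp add: inner_htensor_def simps inner_add_left)
  show "inner (r *\<^sub>R f) g = r * inner f g" by (simp add: inner_htensor_def simps)
  show "0 \<le> inner f f" by (simp add: inner_htensor_def)
  show "inner f f = 0 \<longleftrightarrow> f = 0" by (simp add: inner_htensor_def simps)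
  show "norm f = sqrt (inner f f)"
    by (simp add: norm_htensor_def inner_htensor_def norm_eq_sqrt_inner)
  show "sgn f = inverse (norm f) *\<^sub>R f" by (rule sgn_htensor_def)
  show "dist f g = norm (f - g)" by (simp add: dist_htensor_def norm_htensor_def simps dist_norm)
  show "(uniformity :: (('a,'b) htensor \<times> ('a,'b) htensor) filter) =
    (INF e\<in>{0 <..}. principal {(x, y). dist x y < e})" by (rule uniformity_htensor_def)
  show "open U = (\<forall>x\<in>U. \<forall>\<^sub>F (x', y) in uniformity. x' = x \<longrightarrow> y \<in> U)"
    for U :: "('a,'b) htensor set"
    by (rule open_htensor_def)
qed

end

instantiation htensor :: (chilbert_space, chilbert_space) chilbert_space
begin

definition "c *\<^sub>C f = Abs_htensor (c *\<^sub>C htensor_ell2 f)"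
definition "cinner f g = cinner (htensor_ell2 f) (htensor_ell2 g)"

lemma htensor_ell2_scaleC: "htensor_ell2 (c *\<^sub>C f :: ('a,'b) htensor) = c *\<^sub>C htensor_ell2 f"
  by (simp add: scaleC_htensor_def htensor_ell2I ell2_fun_scaleC htensor_ell2_outside)

instance
proof
  fix f g h :: "('a,'b) htensor" and r :: real and c d :: complex
  note simps = htensor_ell2_inject[symmetric] htensor_ell2_add htensor_ell2_scaleR
    htensor_ell2_scaleC
  show "c *\<^sub>C (f + g) = c *\<^sub>C f + c *\<^sub>C g" "(c + d) *\<^sub>C f = c *\<^sub>C f + d *\<^sub>C f"
    "c *\<^sub>C d *\<^sub>C f = (c * d) *\<^sub>C f" "complex_of_real r *\<^sub>C f = r *\<^sub>R f"
    by (simp_all add: simps scaleC_add_left scaleC_add_right scaleC_scaleC scaleC_of_real)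
  show "cinner f g = cnj (cinner g f)" unfolding cinner_htensor_def by (rule cinner_commute)
  show "cinner (f + g) h = cinner f h + cinner g h"
    by (simp add: cinner_htensor_def simps cinner_add_left)
  show "cinner (c *\<^sub>C f) g = c * cinner f g"
    by (simp add: cinner_htensor_def simps cinner_scaleC_left)
  show "Re (cinner f g) = inner f g"
    by (simp add: cinner_htensor_def inner_htensor_def Re_cinner)
next
  fix X :: "nat \<Rightarrow> ('a,'b) htensor"
  assume "Cauchy X"
  then have "Cauchy (\<lambda>n. htensor_ell2 (X n))" by (simp add: Cauchy_def dist_htensor_def)
  then obtain g where g: "(\<lambda>n. htensor_ell2 (X n)) \<longlonglongrightarrow> g"
    unfolding Cauchy_convergent_iff convergent_def by blast
  have "ell2_fun g a = 0" if "a \<notin> onb" for a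
  proof -
    have "norm (ell2_fun g a) \<le> norm (g - htensor_ell2 (X n))" for n
      using ell2_component_le[of "g - htensor_ell2 (X n)" a] that
      by (simp add: ell2_fun_diff htensor_ell2_outside)
    moreover have "(\<lambda>n. norm (g - htensor_ell2 (X n))) \<longlonglongrightarrow> norm (g - g)"
      by (intro tendsto_intros g)
    ultimately have "norm (ell2_fun g a) \<le> 0"
      by (intro LIMSEQ_le_const[where X = "\<lambda>n. norm (g - htensor_ell2 (X n))"]) auto
    then show ?thesis by simp
  qed
  then have "htensor_ell2 (Abs_htensor g) = g" by (rule htensor_ell2I)
  then have "X \<longlonglongrightarrow> Abs_htensor g"
    using g by (simp add: tendsto_iff dist_htensor_def)
  then show "convergent X" by (auto simp: convergent_def)
qed

end

definition tensor :: "'a::chilbert_space \<Rightarrow> 'b::chilbert_space \<Rightarrow> ('a, 'b) htensor"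
    (infixr \<open>\<otimes>\<^sub>h\<close> 70) where
  "x \<otimes>\<^sub>h y = Abs_htensor (Abs_ell2 (\<lambda>a. if a \<in> onb then cinner x a *\<^sub>C y else 0))"

lemma ell2_fun_tensor:
  "ell2_fun (htensor_ell2 (x \<otimes>\<^sub>h y)) = (\<lambda>a. if a \<in> onb then cinner x a *\<^sub>C y else 0)"
    (is "_ = ?f")
proof -
  have on: "orthonormal (onb::'a set)" using is_onb_onb by (auto simp: is_onb_def)
  have "(\<lambda>a. (cmod (cinner x a))\<^sup>2 * (norm y)\<^sup>2) summable_on onb"
    by (rule summable_on_cmult_left[OF bessel_summable[OF on]])
  then have "(\<lambda>a. (norm (?f a))\<^sup>2) summable_on UNIV"
    by (rule summable_on_cong_neutral[THEN iffD1, rotated -1])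
      (auto simp: norm_scaleC power_mult_distrib)
  then have "ell2_fun (Abs_ell2 ?f) = ?f" by (rule ell2_funI)
  then show ?thesis by (simp add: tensor_def htensor_ell2I)
qed

lemma cinner_tensor: "cinner (x \<otimes>\<^sub>h y) (x' \<otimes>\<^sub>h y') = cinner x x' * cinner y y'"
proof -
  have "cinner (x \<otimes>\<^sub>h y) (x' \<otimes>\<^sub>h y') = (\<Sum>\<^sub>\<infinity>a\<in>onb. cinner (cinner x a *\<^sub>C y) (cinner x' a *\<^sub>C y'))"
    unfolding cinner_htensor_def cinner_ell2_def ell2_fun_tensor
    by (rule infsum_cong_neutral) auto
  also have "\<dots> = (\<Sum>\<^sub>\<infinity>a\<in>onb. cinner (cinner x a *\<^sub>C a) x' * cinner y y')"
    by (rule infsum_cong)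
      (simp add: cinner_scaleC_left cinner_scaleC_right mult_ac cinner_commute[of _ x'])
  also have "\<dots> = (\<Sum>\<^sub>\<infinity>a\<in>onb. cinner (cinner x a *\<^sub>C a) x') * cinner y y'"
    by (rule infsum_cmult_left')
  also have "(\<Sum>\<^sub>\<infinity>a\<in>onb. cinner (cinner x a *\<^sub>C a) x') = cinner x x'"
    by (rule infsumI, rule has_sum_bounded_linear[OF bounded_linear_cinner_left],
        rule onb_expansion[OF is_onb_onb])
  finally show ?thesis .
qed

lemma htensor_eqI:
  "(\<And>a. a \<in> onb \<Longrightarrow> ell2_fun (htensor_ell2 f) a = ell2_fun (htensor_ell2 g) a) \<Longrightarrow> f = g"
  by (metis ell2_eqI htensor_ell2_inject htensor_ell2_outside)

lemma tensor_add_left: "(x + x') \<otimes>\<^sub>h y = x \<otimes>\<^sub>h y + x' \<otimes>\<^sub>h y"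
  by (rule htensor_eqI)
    (simp add: ell2_fun_tensor htensor_ell2_add ell2_fun_add cinner_add_left scaleC_add_left)

lemma tensor_add_right: "x \<otimes>\<^sub>h (y + y') = x \<otimes>\<^sub>h y + x \<otimes>\<^sub>h y'"
  by (rule htensor_eqI)
    (simp add: ell2_fun_tensor htensor_ell2_add ell2_fun_add scaleC_add_right)

lemma tensor_scaleC_left: "(c *\<^sub>C x) \<otimes>\<^sub>h y = c *\<^sub>C (x \<otimes>\<^sub>h y)"
  by (rule htensor_eqI)
    (simp add: ell2_fun_tensor htensor_ell2_scaleC ell2_fun_scaleC cinner_scaleC_left scaleC_scaleC)

lemma tensor_scaleC_right: "x \<otimes>\<^sub>h (c *\<^sub>C y) = c *\<^sub>C (x \<otimes>\<^sub>h y)"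
  by (rule htensor_eqI)
    (simp add: ell2_fun_tensor htensor_ell2_scaleC ell2_fun_scaleC scaleC_scaleC mult.commute)

lemma closure_span_tensor:
  "closure (span {x \<otimes>\<^sub>h y | x y. True}) = (UNIV :: ('a::chilbert_space, 'b::chilbert_space) htensor set)"
proof -
  have "f \<in> closure (span {x \<otimes>\<^sub>h y | x y. True})" for f :: "('a, 'b) htensor"
    unfolding closure_approachable
  proof (intro allI impI)
    fix e :: real assume "0 < e"
    let ?f = "ell2_fun (htensor_ell2 f)"
    obtain A where A: "finite A" "dist (\<Sum>a\<in>A. (norm (?f a))\<^sup>2) (\<Sum>\<^sub>\<infinity>a. (norm (?f a))\<^sup>2) \<le> e\<^sup>2 / 4"
      using infsum_finite_approximation[OF ell2_summable[of "htensor_ell2 f"], of "e\<^sup>2 / 4"] \<open>0 < e\<close>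
      by auto
    define g where "g = (\<Sum>a\<in>A \<inter> onb. a \<otimes>\<^sub>h ?f a)"
    have g: "ell2_fun (htensor_ell2 g) b = (if b \<in> A then ?f b else 0)" for b
    proof -
      have "ell2_fun (htensor_ell2 (\<Sum>a\<in>D. a \<otimes>\<^sub>h ?f a)) b
          = (\<Sum>a\<in>D. ell2_fun (htensor_ell2 (a \<otimes>\<^sub>h ?f a)) b)" if "finite D" for D :: "'a set"
        using that
        by (induction D) (auto simp: htensor_ell2_zero ell2_fun_zero htensor_ell2_add ell2_fun_add)
      then have "ell2_fun (htensor_ell2 g) b = (\<Sum>a\<in>A \<inter> onb. ell2_fun (htensor_ell2 (a \<otimes>\<^sub>h ?f a)) b)"
        using A by (simp add: g_def)
      also have "\<dots> = (\<Sum>a\<in>A \<inter> onb. if a = b then ?f b else 0)"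
        using is_onb_onb[where 'a = 'a]
        by (intro sum.cong) (auto simp: ell2_fun_tensor is_onb_def orthonormal_def)
      also have "\<dots> = (if b \<in> A then ?f b else 0)"
        using A by (auto simp: htensor_ell2_outside)
      finally show ?thesis .
    qed
    have "norm (htensor_ell2 g - htensor_ell2 f) \<le> e / 2"
    proof (rule ell2_norm_leI)
      fix D :: "'a set" assume D: "finite D"
      have "(\<Sum>b\<in>D. (norm (ell2_fun (htensor_ell2 g - htensor_ell2 f) b))\<^sup>2) =
          (\<Sum>b\<in>D - A. (norm (?f b))\<^sup>2)"
        using D by (intro sum.mono_neutral_cong_right) (auto simp: ell2_fun_diff g)
      also have "\<dots> = (\<Sum>b\<in>D \<union> A. (norm (?f b))\<^sup>2) - (\<Sum>b\<in>A. (norm (?f b))\<^sup>2)"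
        using D A sum_diff[of "D \<union> A" A "\<lambda>b. (norm (?f b))\<^sup>2"] by (simp add: Un_Diff)
      also have "(\<Sum>b\<in>D \<union> A. (norm (?f b))\<^sup>2) \<le> (\<Sum>\<^sub>\<infinity>a. (norm (?f a))\<^sup>2)"
        by (rule finite_sum_le_infsum) (use D A in \<open>auto intro: ell2_summable\<close>)
      finally have "(\<Sum>b\<in>D. (norm (ell2_fun (htensor_ell2 g - htensor_ell2 f) b))\<^sup>2) \<le> e\<^sup>2 / 4"
        using A(2) unfolding dist_real_def by linarith
      then show "(\<Sum>b\<in>D. (norm (ell2_fun (htensor_ell2 g - htensor_ell2 f) b))\<^sup>2) \<le> (e / 2)\<^sup>2"
        by (simp add: power_divide)
    qed (use \<open>0 < e\<close> in auto)
    then have "dist g f < e" using \<open>0 < e\<close> by (simp add: dist_htensor_def dist_norm)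
    moreover have "g \<in> span {x \<otimes>\<^sub>h y | x y. True}"
      unfolding g_def by (intro span_sum span_base) blast
    ultimately show "\<exists>g\<in>span {x \<otimes>\<^sub>h y | x y. True}. dist g f < e" by blast
  qed
  then show ?thesis by blast
qed

section \<open>Bounded operators\<close>

text \<open>
  \<open>'a \<Rightarrow>\<^sub>L 'b\<close> consists of the bounded real linear maps with the operator norm. The space
  \<open>B('a, 'b)\<close> is its closed subspace \<open>Collect clinear_op\<close>.
\<close>

definition clinear_op :: "('a::chilbert_space \<Rightarrow>\<^sub>L 'b::chilbert_space) \<Rightarrow> bool" where
  "clinear_op T \<longleftrightarrow> (\<forall>c x. blinfun_apply T (c *\<^sub>C x) = c *\<^sub>C blinfun_apply T x)"

definition adj :: "('a::chilbert_space \<Rightarrow>\<^sub>L 'b::chilbert_space) \<Rightarrow> ('b \<Rightarrow>\<^sub>L 'a)" where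
  "adj T = (THE S. \<forall>x y. cinner (blinfun_apply T x) y = cinner x (blinfun_apply S y))"

definition pos_op :: "('a::chilbert_space \<Rightarrow>\<^sub>L 'a) \<Rightarrow> bool" where
  "pos_op T \<longleftrightarrow> (\<forall>x. \<exists>t\<ge>0. cinner (blinfun_apply T x) x = complex_of_real t)"

definition op_ge :: "('a::chilbert_space \<Rightarrow>\<^sub>L 'a) \<Rightarrow> ('a \<Rightarrow>\<^sub>L 'a) \<Rightarrow> bool" where
  "op_ge S T \<longleftrightarrow> pos_op (S - T)"

definition inverse_ops :: "('a::chilbert_space \<Rightarrow>\<^sub>L 'b::chilbert_space) \<Rightarrow> ('b \<Rightarrow>\<^sub>L 'a) \<Rightarrow> bool" where
  "inverse_ops T S \<longleftrightarrow> S o\<^sub>L T = id_blinfun \<and> T o\<^sub>L S = id_blinfun"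

definition invertible_op :: "('a::chilbert_space \<Rightarrow>\<^sub>L 'b::chilbert_space) \<Rightarrow> bool" where
  "invertible_op T \<longleftrightarrow> (\<exists>S. inverse_ops T S)"

definition inv_op :: "('a::chilbert_space \<Rightarrow>\<^sub>L 'b::chilbert_space) \<Rightarrow> ('b \<Rightarrow>\<^sub>L 'a)" where
  "inv_op T = (THE S. inverse_ops T S)"

definition min_modulus :: "('a::chilbert_space \<Rightarrow>\<^sub>L 'b::chilbert_space) \<Rightarrow> real" where
  "min_modulus T = (INF x\<in>{x. norm x = 1}. norm (blinfun_apply T x))"

definition op_tensor :: "('a::chilbert_space \<Rightarrow>\<^sub>L 'c::chilbert_space) \<Rightarrow>
    ('b::chilbert_space \<Rightarrow>\<^sub>L 'd::chilbert_space) \<Rightarrow> (('a, 'b) htensor \<Rightarrow>\<^sub>L ('c, 'd) htensor)" where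
  "op_tensor S T = (THE R. \<forall>x y. blinfun_apply R (x \<otimes>\<^sub>h y) =
     blinfun_apply S x \<otimes>\<^sub>h blinfun_apply T y)"

text \<open>
  The spatial tensor product of \<open>B('a, 'c)\<close> and \<open>B('b, 'd)\<close>. The real span is already a complex
  subspace, because scalars can be moved into the first factor.
\<close>

definition spatial_tensor ::
    "(('a::chilbert_space, 'b::chilbert_space) htensor \<Rightarrow>\<^sub>L
      ('c::chilbert_space, 'd::chilbert_space) htensor) set" where
  "spatial_tensor = closure (span {op_tensor S T | S T. clinear_op S \<and> clinear_op T})"

section \<open>Free holomorphic functions on the noncommutative ball\<close>

text \<open>
  The type \<open>'n::countable\<close> indexes the generators, so \<open>n = CARD('n)\<close> for finite \<open>'n\<close> and
  \<open>n = \<infinity>\<close> otherwise; the free semigroup is \<open>'n list\<close> under concatenation.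
\<close>

primrec word_op :: "('n \<Rightarrow> ('h::chilbert_space \<Rightarrow>\<^sub>L 'h)) \<Rightarrow> 'n list \<Rightarrow> ('h \<Rightarrow>\<^sub>L 'h)" where
  "word_op X [] = id_blinfun"
| "word_op X (i # \<alpha>) = X i o\<^sub>L word_op X \<alpha>"

text \<open>For infinite \<open>'n\<close> the sum of the \<open>X\<^sub>i X\<^sub>i\<^sup>*\<close> is taken in the strong operator topology.\<close>

definition row_square :: "('n \<Rightarrow> ('h::chilbert_space \<Rightarrow>\<^sub>L 'h)) \<Rightarrow> ('h \<Rightarrow>\<^sub>L 'h) \<Rightarrow> bool" where
  "row_square X P \<longleftrightarrow>
     (\<forall>x. ((\<lambda>i. blinfun_apply (X i o\<^sub>L adj (X i)) x) has_sum blinfun_apply P x) UNIV)"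

definition row_ball :: "('n::countable \<Rightarrow> ('h::chilbert_space \<Rightarrow>\<^sub>L 'h)) set" where
  "row_ball = {X. (\<forall>i. clinear_op (X i)) \<and> (\<exists>P. row_square X P \<and> sqrt (norm P) < 1)}"

text \<open>
  \<open>T\<close> is the value at \<open>X\<close> of the free power series with coefficients \<open>A\<close>: the series of
  homogeneous parts converges in the operator norm. Each homogeneous part is a finite sum if \<open>'n\<close>
  is finite, and an unconditional sum in the strong operator topology otherwise.
\<close>

definition free_series_sum :: "('n::countable list \<Rightarrow> ('e::chilbert_space \<Rightarrow>\<^sub>L 'g::chilbert_space)) \<Rightarrow>
    ('n \<Rightarrow> ('h::chilbert_space \<Rightarrow>\<^sub>L 'h)) \<Rightarrow> (('h, 'e) htensor \<Rightarrow>\<^sub>L ('h, 'g) htensor) \<Rightarrow> bool" where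
  "free_series_sum A X T \<longleftrightarrow>
     (\<exists>H. (\<forall>k x. ((\<lambda>\<alpha>. blinfun_apply (op_tensor (word_op X \<alpha>) (A \<alpha>)) x)
                    has_sum blinfun_apply (H k) x) {\<alpha>. length \<alpha> = k}) \<and>
          H sums T)"

definition free_eval :: "('n::countable list \<Rightarrow> ('e::chilbert_space \<Rightarrow>\<^sub>L 'g::chilbert_space)) \<Rightarrow>
    ('n \<Rightarrow> ('h::chilbert_space \<Rightarrow>\<^sub>L 'h)) \<Rightarrow> (('h, 'e) htensor \<Rightarrow>\<^sub>L ('h, 'g) htensor)" where
  "free_eval A X = (THE T. free_series_sum A X T)"

definition free_holomorphic :: "(('n::countable \<Rightarrow> ('h::chilbert_space \<Rightarrow>\<^sub>L 'h)) \<Rightarrow>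
    (('h, 'e::chilbert_space) htensor \<Rightarrow>\<^sub>L ('h, 'g::chilbert_space) htensor)) \<Rightarrow>
    ('n list \<Rightarrow> ('e \<Rightarrow>\<^sub>L 'g)) \<Rightarrow> bool" where
  "free_holomorphic F A \<longleftrightarrow> (\<forall>\<alpha>. clinear_op (A \<alpha>)) \<and>
     (\<forall>X\<in>row_ball. F X \<in> spatial_tensor \<and> free_series_sum A X (F X))"

definition sup_norm :: "(('n::countable \<Rightarrow> ('h::chilbert_space \<Rightarrow>\<^sub>L 'h)) \<Rightarrow>
    (('h, 'e::chilbert_space) htensor \<Rightarrow>\<^sub>L ('h, 'g::chilbert_space) htensor)) \<Rightarrow> real" where
  "sup_norm F = (SUP X\<in>row_ball. norm (F X))"

section \<open>The full Fock space\<close>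

text \<open>The orthonormal basis \<open>e\<^sub>\<alpha>\<close> of the full Fock space is indexed by the words \<open>\<alpha>\<close>.\<close>

type_synonym 'n fock = "('n list, complex) ell2"

definition creation_fun :: "'n \<Rightarrow> 'n fock \<Rightarrow> 'n fock" where
  "creation_fun i \<phi> =
     Abs_ell2 (\<lambda>\<alpha>. case \<alpha> of [] \<Rightarrow> 0 | j # \<beta> \<Rightarrow> if j = i then ell2_fun \<phi> \<beta> else 0)"

definition creation :: "'n \<Rightarrow> ('n fock \<Rightarrow>\<^sub>L 'n fock)" where
  "creation i = Blinfun (creation_fun i)"

lemma creation_fun_has_sum:
  "((\<lambda>\<alpha>. (norm (case \<alpha> of [] \<Rightarrow> 0 | j # \<beta> \<Rightarrow> if j = i then ell2_fun \<phi> \<beta> else 0))\<^sup>2)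
     has_sum (norm (\<phi> :: 'n fock))\<^sup>2) UNIV"
proof -
  have "((\<lambda>\<beta>. (norm (ell2_fun \<phi> \<beta>))\<^sup>2) has_sum (norm \<phi>)\<^sup>2) UNIV"
    unfolding ell2_norm_sq by (rule has_sum_infsum) (rule ell2_summable)
  then have "((\<lambda>\<alpha>. (norm (ell2_fun \<phi> (tl \<alpha>)))\<^sup>2) has_sum (norm \<phi>)\<^sup>2) (range ((#) i))"
    by (subst has_sum_reindex) (auto simp: o_def)
  then show ?thesis
    by (rule has_sum_cong_neutral[THEN iffD1, rotated -1]) (auto split: list.splits)
qed

lemma ell2_fun_creation_fun:
  "ell2_fun (creation_fun i \<phi>) \<alpha> =
     (case \<alpha> of [] \<Rightarrow> 0 | j # \<beta> \<Rightarrow> if j = i then ell2_fun \<phi> \<beta> else 0)"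
  unfolding creation_fun_def
  by (subst ell2_funI) (use creation_fun_has_sum[of i \<phi>] in \<open>auto simp: summable_on_def\<close>)

lemma norm_creation_fun: "norm (creation_fun i \<phi>) = norm \<phi>"
proof -
  have "(norm (creation_fun i \<phi>))\<^sup>2 = (norm \<phi>)\<^sup>2"
    unfolding ell2_norm_sq[of "creation_fun i \<phi>"] ell2_fun_creation_fun
    by (rule infsumI) (rule creation_fun_has_sum)
  then show ?thesis by simp
qed

lemma creation_apply: "blinfun_apply (creation i) \<phi> = creation_fun i \<phi>"
proof -
  have "bounded_linear (creation_fun i)"
    by (rule bounded_linear_intro[where K = 1])
      (auto intro!: ell2_eqI simp: ell2_fun_creation_fun ell2_fun_add ell2_fun_scaleR
        norm_creation_fun split: list.splits)
  then show ?thesis by (simp add: creation_def bounded_linear_Blinfun_apply)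
qed

definition eval_radial :: "('n::countable list \<Rightarrow> ('e::chilbert_space \<Rightarrow>\<^sub>L 'g::chilbert_space)) \<Rightarrow>
    real \<Rightarrow> (('n fock, 'e) htensor \<Rightarrow>\<^sub>L ('n fock, 'g) htensor)" where
  "eval_radial A r = free_eval A (\<lambda>i. r *\<^sub>R creation i)"

definition radial_infimum_property :: "(('n::countable \<Rightarrow> ('h::chilbert_space \<Rightarrow>\<^sub>L 'h)) \<Rightarrow>
    (('h, 'e::chilbert_space) htensor \<Rightarrow>\<^sub>L ('h, 'g::chilbert_space) htensor)) \<Rightarrow>
    ('n list \<Rightarrow> ('e \<Rightarrow>\<^sub>L 'g)) \<Rightarrow> bool" where
  "radial_infimum_property F A \<longleftrightarrow>
     Liminf (at_left 1) (\<lambda>r. ereal (min_modulus (eval_radial A r))) = ereal (sup_norm F)"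

end

theory Submission
  imports Defs
begin

text \<open>
  Write \<open>T r = F (rS\<^sub>1, rS\<^sub>2, \<dots>)\<close>. Except for the comparison with \<open>\<parallel>F\<parallel>\<^sub>\<infinity>\<close>, each of the conditions is
  about the single operator \<open>T r\<close>, and it can be read off from \<open>s r = (min_modulus (T r))\<^sup>2\<close>: the
  inequality \<open>T\<^sup>*T \<ge> c I\<close> says that \<open>c \<parallel>x\<parallel>\<^sup>2 \<le> \<parallel>T x\<parallel>\<^sup>2\<close> for all \<open>x\<close>, that is \<open>c \<le> s r\<close>
  (\<open>op_ge_gram_iff\<close>, \<open>min_modulus_sq_ge_iff\<close>), and \<open>T\<^sup>*T\<close> is invertible exactly if \<open>s r \<noteq> 0\<close>, with an
  inverse of norm \<open>1 / s r\<close> (\<open>gram_inverse_min_modulus\<close>). Once \<open>s r \<le> 1\<close> is known, all five conditions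
  say that \<open>s r\<close> tends to \<open>1\<close>.

  The substance is therefore the bound \<open>\<parallel>T r\<parallel> \<le> \<parallel>F\<parallel>\<^sub>\<infinity>\<close>. The supremum runs over row contractions on
  the separable infinite dimensional space \<open>'h\<close>, whereas \<open>T r\<close> lives on the full Fock space. The
  words index a countably infinite orthonormal basis of the Fock space, so there is a unitary \<open>U\<close> from
  the Fock space onto \<open>'h\<close> (\<open>fock_unitary_exists\<close>). It carries \<open>(rS\<^sub>1, rS\<^sub>2, \<dots>)\<close> to a strict row
  contraction \<open>X\<close> on \<open>'h\<close> (\<open>unitary_creation_row_ball\<close>), and conjugation by \<open>U \<otimes> I\<close> takes the power
  series at \<open>X\<close> to the one at \<open>(rS\<^sub>1, rS\<^sub>2, \<dots>)\<close> term by term (\<open>eval_radial_unitary\<close>). Hence \<open>T r\<close> is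
  unitarily equivalent to \<open>F X\<close>.

  Adjoints and tensor products of operators are given by descriptions, so their existence has to be
  shown: adjoints come from the Riesz representation theorem, tensor products and unitaries from the
  extension of a bounded prescription on a total set (\<open>bounded_extension\<close>).
\<close>

section \<open>Extending operators from a total set\<close>

lemma closure_span_subspace:
  fixes G :: "'a::real_normed_vector set"
  shows "subspace (closure (span G))"
proof (rule subspaceI)
  show "0 \<in> closure (span G)" using closure_subset span_zero by blast
  show "x + y \<in> closure (span G)" if x: "x \<in> closure (span G)" and y: "y \<in> closure (span G)" for x y
  proof -
    obtain s t where s: "\<And>n. s n \<in> span G" "s \<longlonglongrightarrow> x" and t: "\<And>n. t n \<in> span G" "t \<longlonglongrightarrow> y"
      using x y unfolding closure_sequential by blast
    have "(\<lambda>n. s n + t n) \<longlonglongrightarrow> x + y" by (intro tendsto_intros s t)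
    moreover have "s n + t n \<in> span G" for n using s t by (simp add: span_add)
    ultimately show ?thesis
      unfolding closure_sequential by (intro exI[of _ "\<lambda>n. s n + t n"]) simp
  qed
  show "c *\<^sub>R x \<in> closure (span G)" if x: "x \<in> closure (span G)" for c x
  proof -
    obtain s where s: "\<And>n. s n \<in> span G" "s \<longlonglongrightarrow> x"
      using x unfolding closure_sequential by blast
    have "(\<lambda>n. c *\<^sub>R s n) \<longlonglongrightarrow> c *\<^sub>R x" by (intro tendsto_intros s)
    moreover have "c *\<^sub>R s n \<in> span G" for n using s by (simp add: span_scale)
    ultimately show ?thesis
      unfolding closure_sequential by (intro exI[of _ "\<lambda>n. c *\<^sub>R s n"]) simp
  qed
qed

text \<open>
  The prescribed values are the pairs in \<open>G\<close>. The norm bound passes to the closure of the span of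
  \<open>G\<close> in the product space, so this closure is the graph of a bounded operator; completeness of
  the target and density of the first projections make the operator total.
\<close>

lemma bounded_extension:
  fixes G :: "('a::real_normed_vector \<times> 'b::banach) set"
  assumes dense: "closure (span (fst ` G)) = UNIV"
    and bound: "\<And>p. p \<in> span G \<Longrightarrow> norm (snd p) \<le> C * norm (fst p)"
    and C: "0 \<le> C"
  obtains T :: "'a \<Rightarrow>\<^sub>L 'b" where "\<And>x y. (x, y) \<in> G \<Longrightarrow> blinfun_apply T x = y" "norm T \<le> C"
proof -
  define K where "K = closure (span G)"
  have K: "subspace K" unfolding K_def by (rule closure_span_subspace)
  have bK: "norm (snd p) \<le> C * norm (fst p)" if "p \<in> K" for p
  proof -
    have "closed {p :: 'a \<times> 'b. norm (snd p) \<le> C * norm (fst p)}"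
      by (intro closed_Collect_le continuous_intros)
    moreover have "span G \<subseteq> {p :: 'a \<times> 'b. norm (snd p) \<le> C * norm (fst p)}" using bound by auto
    ultimately have "K \<subseteq> {p :: 'a \<times> 'b. norm (snd p) \<le> C * norm (fst p)}"
      unfolding K_def by (rule closure_minimal[rotated])
    then show ?thesis using that by auto
  qed
  have "\<exists>y. (x, y) \<in> K" for x
  proof -
    have "span (fst ` G) = fst ` span G"
      by (rule linear_span_image) (rule bounded_linear.linear[OF bounded_linear_fst])
    then have "x \<in> closure (fst ` span G)" using dense by simp
    then obtain s where s: "\<And>n. s n \<in> fst ` span G" "s \<longlonglongrightarrow> x"
      unfolding closure_sequential by blast
    then have "\<forall>n. \<exists>y. (s n, y) \<in> span G" by force
    then obtain t where t: "\<And>n. (s n, t n) \<in> span G" by metis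
    have diff: "norm (t m - t n) \<le> C * norm (s m - s n)" for m n
      using bound[OF span_diff[OF t[of m] t[of n]]] by simp
    have "Cauchy t"
    proof (rule metric_CauchyI)
      fix e :: real assume "0 < e"
      then have "0 < e / (C + 1)" using C by simp
      then obtain M where M: "\<And>m n. m \<ge> M \<Longrightarrow> n \<ge> M \<Longrightarrow> dist (s m) (s n) < e / (C + 1)"
        using metric_CauchyD[OF LIMSEQ_imp_Cauchy[OF s(2)]] by blast
      have "dist (t m) (t n) < e" if "m \<ge> M" "n \<ge> M" for m n
      proof -
        have "norm (t m - t n) \<le> C * (e / (C + 1))"
          using diff[of m n] mult_left_mono[OF less_imp_le[OF M[OF that]] C]
          by (simp add: dist_norm)
        also have "\<dots> < e" using C \<open>0 < e\<close> by (simp add: field_simps)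
        finally show ?thesis by (simp add: dist_norm)
      qed
      then show "\<exists>M. \<forall>m\<ge>M. \<forall>n\<ge>M. dist (t m) (t n) < e" by blast
    qed
    then obtain y where y: "t \<longlonglongrightarrow> y" using Cauchy_convergent convergent_def by blast
    have "(\<lambda>n. (s n, t n)) \<longlonglongrightarrow> (x, y)" by (intro tendsto_Pair s y)
    then show ?thesis
      unfolding K_def closure_sequential
      by (intro exI[of _ y] exI[of _ "\<lambda>n. (s n, t n)"]) (simp add: t)
  qed
  then obtain T where T: "\<And>x. (x, T x) \<in> K" by metis
  have T_eq: "T x = y" if "(x, y) \<in> K" for x y
    using bK[OF subspace_diff[OF K T[of x] that]] by simp
  have "bounded_linear T"
  proof (rule bounded_linear_intro)
    show "T (x + y) = T x + T y" for x y
      using subspace_add[OF K T[of x] T[of y]] by (intro T_eq) simp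
    show "T (r *\<^sub>R x) = r *\<^sub>R T x" for r x
      using subspace_scale[OF K T[of x], of r] by (intro T_eq) simp
    show "norm (T x) \<le> norm x * C" for x using bK[OF T[of x]] by (simp add: mult.commute)
  qed
  note app = bounded_linear_Blinfun_apply[OF this]
  show thesis
  proof
    show "blinfun_apply (Blinfun T) x = y" if "(x, y) \<in> G" for x y
      unfolding app by (rule T_eq) (use that closure_subset span_superset in \<open>force simp: K_def\<close>)
    show "norm (Blinfun T) \<le> C"
      by (rule norm_blinfun_bound[OF C]) (use bK[OF T] in \<open>auto simp: app\<close>)
  qed
qed

lemma blinfun_eq_on_total_set:
  fixes S T :: "'a::real_normed_vector \<Rightarrow>\<^sub>L 'b::real_normed_vector"
  assumes "closure (span G) = UNIV" "\<And>x. x \<in> G \<Longrightarrow> blinfun_apply S x = blinfun_apply T x"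
  shows "S = T"
proof (rule blinfun_eqI)
  fix x
  have "subspace {x. blinfun_apply S x = blinfun_apply T x}"
    by (rule subspaceI) (auto simp: blinfun.add_right blinfun.scaleR_right)
  then have "span G \<subseteq> {x. blinfun_apply S x = blinfun_apply T x}"
    using assms(2) by (intro span_minimal) auto
  moreover have "closed {x. blinfun_apply S x = blinfun_apply T x}"
    by (intro closed_Collect_eq continuous_intros)
  ultimately have "closure (span G) \<subseteq> {x. blinfun_apply S x = blinfun_apply T x}"
    by (rule closure_minimal)
  then show "blinfun_apply S x = blinfun_apply T x" using assms(1) by auto
qed

lemma inner_eq_on_span:
  fixes G :: "('a::real_inner \<times> 'b::real_inner) set"
  assumes G: "\<And>p q. p \<in> G \<Longrightarrow> q \<in> G \<Longrightarrow> inner (fst p) (fst q) = inner (snd p) (snd q)"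
    and "p \<in> span G" "q \<in> span G"
  shows "inner (fst p) (fst q) = inner (snd p) (snd q)"
proof -
  let ?P = "\<lambda>p q. inner (fst p) (fst q) = inner (snd p) (snd q)"
  have right: "?P p q" if "p \<in> G" "q \<in> span G" for p q
  proof -
    have "subspace {q. ?P p q}" by (rule subspaceI) (auto simp: inner_add_right)
    then have "span G \<subseteq> {q. ?P p q}" using G that by (intro span_minimal) auto
    then show ?thesis using that by auto
  qed
  have "subspace {p. ?P p q}" by (rule subspaceI) (auto simp: inner_add_left)
  then have "span G \<subseteq> {p. ?P p q}" using right assms(3) by (intro span_minimal) auto
  then show ?thesis using assms(2) by auto
qed

section \<open>Complex linear operators\<close>

lemma clinear_opI: "(\<And>c x. blinfun_apply T (c *\<^sub>C x) = c *\<^sub>C blinfun_apply T x) \<Longrightarrow> clinear_op T"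
  by (simp add: clinear_op_def)

lemma clinear_op_scaleC: "clinear_op T \<Longrightarrow> blinfun_apply T (c *\<^sub>C x) = c *\<^sub>C blinfun_apply T x"
  by (simp add: clinear_op_def)

lemma clinear_op_compose: "clinear_op S \<Longrightarrow> clinear_op T \<Longrightarrow> clinear_op (S o\<^sub>L T)"
  by (simp add: clinear_op_def)

lemma clinear_op_id: "clinear_op id_blinfun"
  by (simp add: clinear_op_def)

lemma clinear_op_scaleR: "clinear_op T \<Longrightarrow> clinear_op (r *\<^sub>R T)"
  by (simp add: clinear_op_def blinfun.scaleR_left scaleC_scaleR)

lemma clinear_op_add: "clinear_op S \<Longrightarrow> clinear_op T \<Longrightarrow> clinear_op (S + T)"
  by (simp add: clinear_op_def blinfun.add_left scaleC_add_right)

lemma bounded_linear_scaleC: "bounded_linear (\<lambda>x::'a::chilbert_space. c *\<^sub>C x)"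
  by (rule bounded_linear_intro[where K = "cmod c"])
    (simp_all add: scaleC_add_right scaleC_scaleR norm_scaleC mult.commute)

lemma closed_clinear_op: "closed (Collect clinear_op)"
proof -
  have "Collect clinear_op = (\<Inter>c x. {T :: 'a \<Rightarrow>\<^sub>L 'b. blinfun_apply T (c *\<^sub>C x) = c *\<^sub>C blinfun_apply T x})"
    by (auto simp: clinear_op_def)
  also have "closed \<dots>"
    by (intro closed_INT ballI closed_Collect_eq continuous_intros
        bounded_linear.continuous_on[OF bounded_linear_scaleC])
  finally show ?thesis .
qed

text \<open>
  Multiplication by a complex scalar is a bounded real linear map, so whether \<open>T\<close> commutes with it is
  decided on a total set.
\<close>

lemma clinear_op_on_total_set:
  fixes T :: "'a::chilbert_space \<Rightarrow>\<^sub>L 'b::chilbert_space"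
  assumes "closure (span G) = UNIV"
    and "\<And>c x. x \<in> G \<Longrightarrow> blinfun_apply T (c *\<^sub>C x) = c *\<^sub>C blinfun_apply T x"
  shows "clinear_op T"
proof (rule clinear_opI)
  fix c x
  have "T o\<^sub>L Blinfun (\<lambda>x. c *\<^sub>C x) = Blinfun (\<lambda>x. c *\<^sub>C x) o\<^sub>L T"
    by (rule blinfun_eq_on_total_set[OF assms(1)])
      (simp add: bounded_linear_Blinfun_apply[OF bounded_linear_scaleC] assms(2))
  from arg_cong[OF this, of "\<lambda>S. blinfun_apply S x"]
  show "blinfun_apply T (c *\<^sub>C x) = c *\<^sub>C blinfun_apply T x"
    by (simp add: bounded_linear_Blinfun_apply[OF bounded_linear_scaleC])
qed

text \<open>
  Since \<open>Im z = Re (- \<i> * z)\<close>, the imaginary part of the identity at \<open>x\<close> is its real part at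
  \<open>- \<i> x\<close>.
\<close>

lemma cinner_eq_of_inner_eq:
  assumes T: "clinear_op T" and eq: "\<And>x. inner (blinfun_apply T x) y = inner x u"
  shows "cinner (blinfun_apply T x) y = cinner x u"
proof (rule complex_eqI)
  have Im: "Im (cinner z w) = inner ((- \<i>) *\<^sub>C z) w" for z w :: "'c::chilbert_space"
    by (simp flip: Re_cinner add: cinner_scaleC_left)
  show "Re (cinner (blinfun_apply T x) y) = Re (cinner x u)" using eq by (simp add: Re_cinner)
  show "Im (cinner (blinfun_apply T x) y) = Im (cinner x u)"
    unfolding Im clinear_op_scaleC[OF T, symmetric] by (rule eq)
qed

section \<open>Adjoints\<close>

text \<open>
  The Riesz representation theorem: a minimizing sequence of \<open>\<parallel>x\<parallel>\<^sup>2 - 2 f x\<close> is a Cauchy sequence by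
  the parallelogram law, and at its limit \<open>u\<close> the derivative \<open>2 (\<langle>u, x\<rangle> - f x)\<close> vanishes in every
  direction \<open>x\<close>.
\<close>

lemma riesz_representation:
  fixes f :: "'a::{real_inner, complete_space} \<Rightarrow> real"
  assumes f: "bounded_linear f"
  obtains u where "\<And>x. f x = inner x u"
proof -
  interpret f: bounded_linear f by (rule f)
  define J where "J x = (norm x)\<^sup>2 - 2 * f x" for x
  obtain K where K: "\<And>x. norm (f x) \<le> norm x * K" using f.bounded by blast
  have "- (K\<^sup>2) \<le> J x" for x
  proof -
    have "0 \<le> (norm x - K)\<^sup>2" by simp
    then show ?thesis using K[of x] by (simp add: J_def power2_diff)
  qed
  then have bdd: "bdd_below (range J)" by (auto intro!: bdd_belowI)
  define m where "m = (INF x. J x)"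
  have m: "m \<le> J x" for x unfolding m_def by (rule cINF_lower[OF bdd]) simp
  have "\<exists>x. J x < m + inverse (real (Suc n))" for n
    using cINF_less_iff[OF _ bdd, of "m + inverse (real (Suc n))"] by (simp add: m_def)
  then obtain s where s: "\<And>n. J (s n) < m + inverse (real (Suc n))" by metis
  have par: "(norm (x - y))\<^sup>2 \<le> 2 * (J x - m) + 2 * (J y - m)" for x y
  proof -
    have "J ((1/2) *\<^sub>R (x + y)) = (norm (x + y))\<^sup>2 / 4 - (f x + f y)"
      by (simp add: J_def f.scaleR f.add power_divide add_divide_distrib)
    moreover have "(norm (x + y))\<^sup>2 + (norm (x - y))\<^sup>2 = 2 * (norm x)\<^sup>2 + 2 * (norm y)\<^sup>2"
      by (simp add: power2_norm_eq_inner inner_add_left inner_add_right inner_diff_left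
          inner_diff_right)
    ultimately show ?thesis using m[of "(1/2) *\<^sub>R (x + y)"] by (simp add: J_def)
  qed
  have "Cauchy s"
  proof (rule metric_CauchyI)
    fix e :: real assume "0 < e"
    then obtain M where M: "inverse (real (Suc M)) < e\<^sup>2 / 4"
      using reals_Archimedean[of "e\<^sup>2 / 4"] by auto
    have "dist (s k) (s n) < e" if "k \<ge> M" "n \<ge> M" for k n
    proof -
      have small: "J (s n) - m < e\<^sup>2 / 4" if "n \<ge> M" for n
      proof -
        have "inverse (real (Suc n)) \<le> inverse (real (Suc M))" using that by simp
        then show ?thesis using s[of n] M by linarith
      qed
      have "(norm (s k - s n))\<^sup>2 < 2 * (e\<^sup>2 / 4) + 2 * (e\<^sup>2 / 4)"
        by (rule order.strict_trans1[OF par])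
          (intro add_strict_mono mult_strict_left_mono small that, simp_all)
      also have "\<dots> = e\<^sup>2" by simp
      finally have "(norm (s k - s n))\<^sup>2 < e\<^sup>2" .
      then show ?thesis using \<open>0 < e\<close> by (simp add: dist_norm power_less_imp_less_base)
    qed
    then show "\<exists>M. \<forall>k\<ge>M. \<forall>n\<ge>M. dist (s k) (s n) < e" by blast
  qed
  then obtain u where u: "s \<longlonglongrightarrow> u" using Cauchy_convergent convergent_def by blast
  have "J u \<le> m"
  proof (rule LIMSEQ_le)
    show "(\<lambda>n. J (s n)) \<longlonglongrightarrow> J u" unfolding J_def by (intro tendsto_intros u f.tendsto)
    show "(\<lambda>n. m + inverse (real (Suc n))) \<longlonglongrightarrow> m"
      using tendsto_add[OF tendsto_const LIMSEQ_inverse_real_of_nat, of m] by simp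
  qed (use s in \<open>auto intro: less_imp_le\<close>)
  have "f x = inner x u" for x
  proof (cases "x = 0")
    case False
    define d where "d = inner x u - f x"
    have "J u \<le> J (u + t *\<^sub>R x)" for t using \<open>J u \<le> m\<close> m order.trans by blast
    moreover have "J (u + t *\<^sub>R x) = J u + 2 * t * d + t\<^sup>2 * (norm x)\<^sup>2" for t
    proof -
      have "(norm (u + t *\<^sub>R x))\<^sup>2 = (norm u)\<^sup>2 + 2 * t * inner x u + t\<^sup>2 * (norm x)\<^sup>2"
        unfolding power2_norm_eq_inner
        by (simp add: inner_add_left inner_add_right inner_commute power2_eq_square)
      then show ?thesis by (simp add: J_def d_def f.add f.scaleR algebra_simps)
    qed
    ultimately have "0 \<le> 2 * t * d + t\<^sup>2 * (norm x)\<^sup>2" for t by (metis add.assoc le_add_same_cancel1)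
    from this[of "- d / (norm x)\<^sup>2"] have "0 \<le> - (d\<^sup>2 / (norm x)\<^sup>2)"
      using False by (simp add: field_simps power2_eq_square)
    then have "d = 0" using False by (simp add: divide_le_0_iff)
    then show ?thesis by (simp add: d_def)
  qed (simp add: f.zero)
  then show thesis by (rule that)
qed

lemma adj_unique:
  assumes "\<And>x y. cinner (blinfun_apply T x) y = cinner x (blinfun_apply S y)"
  shows "adj T = S"
  unfolding adj_def
proof (rule the_equality)
  fix R assume R: "\<forall>x y. cinner (blinfun_apply T x) y = cinner x (blinfun_apply R y)"
  show "R = S"
  proof (rule blinfun_eqI)
    fix y
    have "cinner x (blinfun_apply R y - blinfun_apply S y) = 0" for x
      using R assms by (simp add: cinner_diff_right)
    from this[of "blinfun_apply R y - blinfun_apply S y"]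
    show "blinfun_apply R y = blinfun_apply S y" by (simp add: cinner_self)
  qed
qed (use assms in blast)

lemma adj_exists:
  assumes T: "clinear_op T"
  shows "\<exists>S. (\<forall>x y. cinner (blinfun_apply T x) y = cinner x (blinfun_apply S y)) \<and> norm S \<le> norm T"
proof -
  have "\<exists>u. \<forall>x. inner (blinfun_apply T x) y = inner x u" for y
  proof -
    have "bounded_linear (\<lambda>x. inner (blinfun_apply T x) y)"
      by (intro bounded_linear_intros)
    then obtain u where "\<And>x. inner (blinfun_apply T x) y = inner x u"
      by (rule riesz_representation) blast
    then show ?thesis by blast
  qed
  then obtain S where S: "\<And>x y. inner (blinfun_apply T x) y = inner x (S y)" by metis
  have S_eq: "S y = z" if "\<And>x. inner x (S y) = inner x z" for y z
    using that[of "S y - z"] inner_eq_zero_iff[of "S y - z"]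
    by (metis eq_iff_diff_eq_0 inner_diff_right)
  have bd: "norm (S y) \<le> norm y * norm T" for y
  proof -
    have "norm (S y) * norm (S y) = inner (blinfun_apply T (S y)) y"
      by (simp add: S power2_norm_eq_inner flip: power2_eq_square)
    also have "\<dots> \<le> norm (blinfun_apply T (S y)) * norm y" by (rule norm_cauchy_schwarz)
    also have "\<dots> \<le> norm T * norm (S y) * norm y" by (intro mult_right_mono norm_blinfun) simp
    finally show ?thesis by (cases "S y = 0") (simp_all add: mult_ac)
  qed
  have "bounded_linear S"
  proof (rule bounded_linear_intro[OF _ _ bd])
    show "S (x + y) = S x + S y" for x y
      by (rule S_eq) (simp add: inner_add_right flip: S)
    show "S (r *\<^sub>R x) = r *\<^sub>R S x" for r x
      by (rule S_eq) (simp flip: S)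
  qed
  then have app: "blinfun_apply (Blinfun S) = S" by (rule bounded_linear_Blinfun_apply)
  show ?thesis
  proof (intro exI conjI allI)
    show "cinner (blinfun_apply T x) y = cinner x (blinfun_apply (Blinfun S) y)" for x y
      unfolding app by (rule cinner_eq_of_inner_eq[OF T S])
    show "norm (Blinfun S) \<le> norm T"
      by (rule norm_blinfun_bound) (use bd in \<open>auto simp: app mult.commute\<close>)
  qed
qed

lemma
  assumes "clinear_op T"
  shows cinner_adj: "cinner (blinfun_apply T x) y = cinner x (blinfun_apply (adj T) y)"
    and norm_adj_le: "norm (adj T) \<le> norm T"
  using adj_exists[OF assms] adj_unique by metis+

section \<open>Unitaries\<close>

text \<open>
  Mutually inverse contractions are isometric, so these are the unitaries \<open>U\<close> with \<open>W = U\<^sup>*\<close>. Keeping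
  the inverse as an explicit operator makes the notion symmetric, and the norm bounds pass directly to
  \<open>U \<otimes> I\<close>.
\<close>

definition unitary_pair :: "('a::chilbert_space \<Rightarrow>\<^sub>L 'b::chilbert_space) \<Rightarrow> ('b \<Rightarrow>\<^sub>L 'a) \<Rightarrow> bool" where
  "unitary_pair U W \<longleftrightarrow>
     clinear_op U \<and> clinear_op W \<and> norm U \<le> 1 \<and> norm W \<le> 1 \<and> inverse_ops U W"

lemma unitary_pair_apply:
  assumes "unitary_pair U W"
  shows "blinfun_apply U (blinfun_apply W y) = y" "blinfun_apply W (blinfun_apply U x) = x"
  using assms unfolding unitary_pair_def inverse_ops_def
  by (metis blinfun_apply_blinfun_compose id_blinfun.rep_eq id_apply)+

lemma unitary_pair_sym: "unitary_pair U W \<Longrightarrow> unitary_pair W U"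
  by (simp add: unitary_pair_def inverse_ops_def)

lemma norm_apply_le_of_contraction: "norm T \<le> 1 \<Longrightarrow> norm (blinfun_apply T x) \<le> norm x"
  using norm_blinfun[of T x] mult_right_mono[of "norm T" 1 "norm x"] by simp

lemma unitary_pair_norm:
  assumes "unitary_pair U W"
  shows "norm (blinfun_apply U x) = norm x"
  using norm_apply_le_of_contraction[of U x]
    norm_apply_le_of_contraction[of W "blinfun_apply U x"] assms
  by (simp add: unitary_pair_apply[OF assms] unitary_pair_def)

text \<open>By polarization, an isometry preserves inner products.\<close>

lemma unitary_pair_cinner:
  assumes U: "unitary_pair U W"
  shows "cinner (blinfun_apply U x) y = cinner x (blinfun_apply W y)"
proof (rule cinner_eq_of_inner_eq)
  show "clinear_op U" using U by (simp add: unitary_pair_def)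
  fix x
  let ?v = "blinfun_apply W y"
  have sq: "inner (blinfun_apply U z) (blinfun_apply U z) = inner z z" for z
    using unitary_pair_norm[OF U, of z] by (simp add: norm_eq_sqrt_inner)
  have "inner (blinfun_apply U x) (blinfun_apply U ?v) = inner x ?v"
    using sq[of "x + ?v"] sq[of x] sq[of ?v]
    by (simp add: blinfun.add_right inner_add_left inner_add_right inner_commute)
  then show "inner (blinfun_apply U x) y = inner x ?v" by (simp add: unitary_pair_apply[OF U])
qed

text \<open>
  Equality of inner products passes to the spans by bilinearity, so the prescription and its reverse
  are both isometric there; their extensions are inverse to each other because they are so on total
  sets.
\<close>

lemma unitary_extension:
  fixes G :: "('a::chilbert_space \<times> 'b::chilbert_space) set"
  assumes inner_eq: "\<And>p q. p \<in> G \<Longrightarrow> q \<in> G \<Longrightarrow> inner (fst p) (fst q) = inner (snd p) (snd q)"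
    and dense: "closure (span (fst ` G)) = UNIV" "closure (span (snd ` G)) = UNIV"
    and scale: "\<And>c p. p \<in> G \<Longrightarrow> (c *\<^sub>C fst p, c *\<^sub>C snd p) \<in> G"
  obtains U W where "unitary_pair U W" "\<And>x y. (x, y) \<in> G \<Longrightarrow> blinfun_apply U x = y"
proof -
  have "norm (snd p) \<le> 1 * norm (fst p)" if "p \<in> span G" for p
    using inner_eq_on_span[of G p p] inner_eq that by (simp add: norm_eq_sqrt_inner)
  then obtain U where U: "\<And>x y. (x, y) \<in> G \<Longrightarrow> blinfun_apply U x = y" "norm U \<le> 1"
    using bounded_extension[OF dense(1), of 1] by (metis zero_le_one)
  have "norm (snd p) \<le> 1 * norm (fst p)" if "p \<in> span (prod.swap ` G)" for p
    using inner_eq_on_span[of "prod.swap ` G" p p] inner_eq that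
    by (fastforce simp: norm_eq_sqrt_inner)
  moreover have "closure (span (fst ` prod.swap ` G)) = UNIV" using dense(2) by (simp add: image_image)
  ultimately obtain W where W: "\<And>y x. (y, x) \<in> prod.swap ` G \<Longrightarrow> blinfun_apply W y = x" "norm W \<le> 1"
    using bounded_extension[of "prod.swap ` G" 1] by (metis zero_le_one)
  have W': "blinfun_apply W y = x" if "(x, y) \<in> G" for x y
    using W(1)[of y x] that by force
  have "clinear_op U"
  proof (rule clinear_op_on_total_set[OF dense(1)])
    fix c x assume "x \<in> fst ` G"
    then obtain y where "(x, y) \<in> G" by force
    then show "blinfun_apply U (c *\<^sub>C x) = c *\<^sub>C blinfun_apply U x"
      using U(1) scale[of "(x, y)" c] by simp
  qed
  moreover have "clinear_op W"
  proof (rule clinear_op_on_total_set[OF dense(2)])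
    fix c y assume "y \<in> snd ` G"
    then obtain x where "(x, y) \<in> G" by force
    then show "blinfun_apply W (c *\<^sub>C y) = c *\<^sub>C blinfun_apply W y"
      using W' scale[of "(x, y)" c] by simp
  qed
  moreover have "W o\<^sub>L U = id_blinfun"
    by (rule blinfun_eq_on_total_set[OF dense(1)]) (use U(1) W' in auto)
  moreover have "U o\<^sub>L W = id_blinfun"
    by (rule blinfun_eq_on_total_set[OF dense(2)]) (use U(1) W' in auto)
  ultimately have "unitary_pair U W" using U W by (simp add: unitary_pair_def inverse_ops_def)
  then show thesis using U(1) by (rule that)
qed

lemma is_onb_total:
  assumes "is_onb B"
  shows "closure (span {c *\<^sub>C b | c b. b \<in> B}) = UNIV"
proof -
  have "x \<in> closure (span {c *\<^sub>C b | c b. b \<in> B})" for x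
  proof (rule Lim_in_closed_set)
    show "((\<lambda>F. \<Sum>a\<in>F. cinner x a *\<^sub>C a) \<longlongrightarrow> x) (finite_subsets_at_top B)"
      using onb_expansion[OF assms] by (simp add: has_sum_def)
    have "(\<Sum>a\<in>F. cinner x a *\<^sub>C a) \<in> closure (span {c *\<^sub>C b | c b. b \<in> B})" if "F \<subseteq> B" for F
    proof -
      have "(\<Sum>a\<in>F. cinner x a *\<^sub>C a) \<in> span {c *\<^sub>C b | c b. b \<in> B}"
        by (intro span_sum span_base) (use that in blast)
      then show ?thesis using closure_subset by blast
    qed
    then show "\<forall>\<^sub>F F in finite_subsets_at_top B.
        (\<Sum>a\<in>F. cinner x a *\<^sub>C a) \<in> closure (span {c *\<^sub>C b | c b. b \<in> B})"
      by (auto intro: eventually_finite_subsets_at_top_weakI)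
  qed auto
  then show ?thesis by auto
qed

lemma unitary_of_bij_onb:
  fixes B :: "'a::chilbert_space set" and B' :: "'b::chilbert_space set"
  assumes B: "is_onb B" and B': "is_onb B'" and w: "bij_betw w B B'"
  obtains U :: "'a \<Rightarrow>\<^sub>L 'b" and W where "unitary_pair U W"
proof -
  define G where "G = {(c *\<^sub>C b, c *\<^sub>C w b) | c b. b \<in> B}"
  have inner_eq: "inner (fst p) (fst q) = inner (snd p) (snd q)" if "p \<in> G" "q \<in> G" for p q
  proof -
    obtain c b d b' where *: "p = (c *\<^sub>C b, c *\<^sub>C w b)" "q = (d *\<^sub>C b', d *\<^sub>C w b')" "b \<in> B" "b' \<in> B"
      using \<open>p \<in> G\<close> \<open>q \<in> G\<close> unfolding G_def by blast
    have "cinner b b' = cinner (w b) (w b')"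
      using B B' w * bij_betw_apply[OF w] inj_on_eq_iff[OF bij_betw_imp_inj_on[OF w]]
      unfolding is_onb_def orthonormal_def by metis
    then show ?thesis by (simp add: * cinner_scaleC_left cinner_scaleC_right flip: Re_cinner)
  qed
  have fst: "fst ` G = {c *\<^sub>C b | c b. b \<in> B}" unfolding G_def by force
  have snd: "snd ` G = {c *\<^sub>C b | c b. b \<in> B'}"
    unfolding G_def bij_betw_imp_surj_on[OF w, symmetric] by force
  have "(c *\<^sub>C fst p, c *\<^sub>C snd p) \<in> G" if "p \<in> G" for c p
    using that unfolding G_def by (force simp: scaleC_scaleC)
  with inner_eq obtain U :: "'a \<Rightarrow>\<^sub>L 'b" and W where "unitary_pair U W"
    by (rule unitary_extension[of G, unfolded fst snd, OF _ is_onb_total[OF B] is_onb_total[OF B']])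
      blast+
  then show thesis by (rule that)
qed

section \<open>Tensor products of operators\<close>

text \<open>The coordinates of \<open>x \<otimes>\<^sub>h y\<close> are multiples of \<open>y\<close>, so the second factor acts coordinatewise.\<close>

lemma id_tensor_exists:
  fixes T :: "'b::chilbert_space \<Rightarrow>\<^sub>L 'd::chilbert_space"
  assumes T: "clinear_op T"
  shows "\<exists>R :: ('a::chilbert_space, 'b) htensor \<Rightarrow>\<^sub>L ('a, 'd) htensor.
    (\<forall>x y. blinfun_apply R (x \<otimes>\<^sub>h y) = x \<otimes>\<^sub>h blinfun_apply T y) \<and> norm R \<le> norm T"
proof -
  define G where "G = {((x::'a) \<otimes>\<^sub>h y, x \<otimes>\<^sub>h blinfun_apply T y) | x y. True}"
  let ?Q = "\<lambda>p. \<forall>a. ell2_fun (htensor_ell2 (snd p)) a = blinfun_apply T (ell2_fun (htensor_ell2 (fst p)) a)"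
  have coord: "?Q p" if "p \<in> span G" for p
  proof -
    have "subspace (Collect ?Q)"
      by (rule subspaceI)
        (auto simp: htensor_ell2_zero ell2_fun_zero htensor_ell2_add ell2_fun_add htensor_ell2_scaleR
          ell2_fun_scaleR blinfun.add_right blinfun.scaleR_right)
    moreover have "G \<subseteq> Collect ?Q"
      by (auto simp: G_def ell2_fun_tensor clinear_op_scaleC[OF T])
    ultimately have "span G \<subseteq> Collect ?Q" by (rule span_minimal[rotated])
    then show ?thesis using that by blast
  qed
  have bound: "norm (snd p) \<le> norm T * norm (fst p)" if p: "p \<in> span G" for p
    unfolding norm_htensor_def
  proof (rule ell2_norm_leI)
    fix A :: "'a set" assume A: "finite A"
    let ?f = "htensor_ell2 (fst p)"
    have "(\<Sum>i\<in>A. (norm (ell2_fun (htensor_ell2 (snd p)) i))\<^sup>2) \<le> (\<Sum>i\<in>A. (norm T)\<^sup>2 * (norm (ell2_fun ?f i))\<^sup>2)"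
      using coord[OF p] by (intro sum_mono) (simp add: norm_blinfun power_mono flip: power_mult_distrib)
    also have "\<dots> \<le> (norm T)\<^sup>2 * (norm ?f)\<^sup>2"
      unfolding sum_distrib_left[symmetric] by (intro mult_left_mono ell2_finite_sum_le A) simp
    finally show "(\<Sum>i\<in>A. (norm (ell2_fun (htensor_ell2 (snd p)) i))\<^sup>2) \<le> (norm T * norm ?f)\<^sup>2"
      by (simp add: power_mult_distrib)
  qed simp
  have fst: "fst ` G = {x \<otimes>\<^sub>h y | x y. True}" unfolding G_def by force
  obtain R where "\<And>x y. (x, y) \<in> G \<Longrightarrow> blinfun_apply R x = y" "norm R \<le> norm T"
    by (rule bounded_extension[of G "norm T", unfolded fst, OF closure_span_tensor bound]) auto
  then show ?thesis unfolding G_def by blast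
qed

lemma tensor_flip_exists:
  "\<exists>R :: ('a::chilbert_space, 'b::chilbert_space) htensor \<Rightarrow>\<^sub>L ('b, 'a) htensor.
    (\<forall>x y. blinfun_apply R (x \<otimes>\<^sub>h y) = y \<otimes>\<^sub>h x) \<and> norm R \<le> 1"
proof -
  define G where "G = {((x::'a) \<otimes>\<^sub>h (y::'b), y \<otimes>\<^sub>h x) | x y. True}"
  have fst: "fst ` G = {x \<otimes>\<^sub>h y | x y. True}" and snd: "snd ` G = {x \<otimes>\<^sub>h y | x y. True}"
    unfolding G_def by force+
  have "inner (fst p) (fst q) = inner (snd p) (snd q)" if "p \<in> G" "q \<in> G" for p q
    using that unfolding G_def by (auto simp: cinner_tensor mult.commute simp flip: Re_cinner)
  moreover have "(c *\<^sub>C fst p, c *\<^sub>C snd p) \<in> G" if p: "p \<in> G" for c p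
  proof -
    obtain x y where "p = (x \<otimes>\<^sub>h y, y \<otimes>\<^sub>h x)" using p unfolding G_def by blast
    then have "(c *\<^sub>C fst p, c *\<^sub>C snd p) = ((c *\<^sub>C x) \<otimes>\<^sub>h y, y \<otimes>\<^sub>h (c *\<^sub>C x))"
      by (simp add: tensor_scaleC_left tensor_scaleC_right)
    then show ?thesis unfolding G_def by blast
  qed
  ultimately obtain R :: "('a, 'b) htensor \<Rightarrow>\<^sub>L ('b, 'a) htensor" and W
    where "unitary_pair R W" "\<And>x y. (x, y) \<in> G \<Longrightarrow> blinfun_apply R x = y"
    by (rule unitary_extension[of G, unfolded fst snd, OF _ closure_span_tensor closure_span_tensor])
      blast+
  then show ?thesis unfolding G_def unitary_pair_def by blast
qed

lemma blinfun_eq_on_tensor: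
  assumes "\<And>x y. blinfun_apply R (x \<otimes>\<^sub>h y) = blinfun_apply R' (x \<otimes>\<^sub>h y)"
  shows "R = R'"
  by (rule blinfun_eq_on_total_set[OF closure_span_tensor]) (use assms in auto)

lemma norm_compose_le: "norm S \<le> a \<Longrightarrow> norm T \<le> b \<Longrightarrow> norm (S o\<^sub>L T) \<le> a * b"
  by (rule order.trans[OF norm_blinfun_compose])
    (meson mult_mono norm_ge_zero order.trans)

text \<open>\<open>S \<otimes> T\<close> is \<open>(I \<otimes> T) (S \<otimes> I)\<close>, and \<open>S \<otimes> I\<close> is \<open>I \<otimes> S\<close> conjugated by the flip.\<close>

lemma op_tensor_exists:
  assumes S: "clinear_op S" and T: "clinear_op T"
  shows "\<exists>R. (\<forall>x y. blinfun_apply R (x \<otimes>\<^sub>h y) = blinfun_apply S x \<otimes>\<^sub>h blinfun_apply T y) \<and>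
    norm R \<le> norm S * norm T"
proof -
  obtain R1 :: "('a, 'c) htensor \<Rightarrow>\<^sub>L ('c, 'a) htensor"
    where R1: "\<And>x y. blinfun_apply R1 (x \<otimes>\<^sub>h y) = y \<otimes>\<^sub>h x" "norm R1 \<le> 1"
    using tensor_flip_exists by blast
  obtain R2 :: "('c, 'a) htensor \<Rightarrow>\<^sub>L ('c, 'b) htensor"
    where R2: "\<And>x y. blinfun_apply R2 (x \<otimes>\<^sub>h y) = x \<otimes>\<^sub>h blinfun_apply S y" "norm R2 \<le> norm S"
    using id_tensor_exists[OF S] by blast
  obtain R3 :: "('c, 'b) htensor \<Rightarrow>\<^sub>L ('b, 'c) htensor"
    where R3: "\<And>x y. blinfun_apply R3 (x \<otimes>\<^sub>h y) = y \<otimes>\<^sub>h x" "norm R3 \<le> 1"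
    using tensor_flip_exists by blast
  obtain R4 :: "('b, 'c) htensor \<Rightarrow>\<^sub>L ('b, 'd) htensor"
    where R4: "\<And>x y. blinfun_apply R4 (x \<otimes>\<^sub>h y) = x \<otimes>\<^sub>h blinfun_apply T y" "norm R4 \<le> norm T"
    using id_tensor_exists[OF T] by blast
  let ?R = "R4 o\<^sub>L (R3 o\<^sub>L (R2 o\<^sub>L R1))"
  have "norm ?R \<le> norm T * (1 * (norm S * 1))"
    by (intro norm_compose_le R1(2) R2(2) R3(2) R4(2))
  then show ?thesis by (intro exI[of _ ?R]) (simp add: R1 R2 R3 R4 mult.commute)
qed

lemma
  assumes S: "clinear_op S" and T: "clinear_op T"
  shows op_tensor_apply: "blinfun_apply (op_tensor S T) (x \<otimes>\<^sub>h y) = blinfun_apply S x \<otimes>\<^sub>h blinfun_apply T y"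
    and norm_op_tensor_le: "norm (op_tensor S T) \<le> norm S * norm T"
proof -
  obtain R where R: "\<And>x y. blinfun_apply R (x \<otimes>\<^sub>h y) = blinfun_apply S x \<otimes>\<^sub>h blinfun_apply T y"
    and le: "norm R \<le> norm S * norm T"
    using op_tensor_exists[OF S T] by blast
  have "op_tensor S T = R"
    unfolding op_tensor_def by (rule the_equality) (use R in \<open>auto intro: blinfun_eq_on_tensor\<close>)
  then show "blinfun_apply (op_tensor S T) (x \<otimes>\<^sub>h y) = blinfun_apply S x \<otimes>\<^sub>h blinfun_apply T y"
    "norm (op_tensor S T) \<le> norm S * norm T" using R le by auto
qed

lemma op_tensor_compose:
  assumes "clinear_op S" "clinear_op T" "clinear_op S'" "clinear_op T'"
  shows "op_tensor S T o\<^sub>L op_tensor S' T' = op_tensor (S o\<^sub>L S') (T o\<^sub>L T')"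
  by (rule blinfun_eq_on_tensor) (simp add: op_tensor_apply clinear_op_compose assms)

lemma op_tensor_id: "op_tensor id_blinfun id_blinfun = id_blinfun"
  by (rule blinfun_eq_on_tensor) (simp add: op_tensor_apply clinear_op_id)

lemma clinear_op_tensor:
  fixes S :: "'a::chilbert_space \<Rightarrow>\<^sub>L 'c::chilbert_space"
    and T :: "'b::chilbert_space \<Rightarrow>\<^sub>L 'd::chilbert_space"
  assumes S: "clinear_op S" and T: "clinear_op T"
  shows "clinear_op (op_tensor S T)"
proof (rule clinear_op_on_total_set[OF closure_span_tensor])
  fix c and f :: "('a, 'b) htensor" assume "f \<in> {x \<otimes>\<^sub>h y | x y. True}"
  then obtain x y where f: "f = x \<otimes>\<^sub>h y" by blast
  show "blinfun_apply (op_tensor S T) (c *\<^sub>C f) = c *\<^sub>C blinfun_apply (op_tensor S T) f"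
    unfolding f
    by (metis op_tensor_apply[OF S T] clinear_op_scaleC[OF S] tensor_scaleC_left)
qed

lemma spatial_tensor_clinear:
  assumes "T \<in> spatial_tensor"
  shows "clinear_op T"
proof -
  have "subspace (Collect clinear_op)"
    by (rule subspaceI) (auto simp: clinear_op_add clinear_op_scaleR intro: clinear_opI)
  then have "span {op_tensor S T | S T. clinear_op S \<and> clinear_op T} \<subseteq> Collect clinear_op"
    by (rule span_minimal[rotated]) (auto intro: clinear_op_tensor)
  then have "spatial_tensor \<subseteq> Collect clinear_op"
    unfolding spatial_tensor_def by (rule closure_minimal[OF _ closed_clinear_op])
  then show ?thesis using assms by blast
qed

lemma norm_tensor_id_le:
  assumes "clinear_op V" "norm V \<le> 1"
  shows "norm (op_tensor V (id_blinfun :: 'e::chilbert_space \<Rightarrow>\<^sub>L 'e)) \<le> 1"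
proof -
  have "norm (id_blinfun :: 'e \<Rightarrow>\<^sub>L 'e) \<le> 1" by (rule norm_blinfun_bound) auto
  from mult_mono[OF assms(2) this]
  show ?thesis using norm_op_tensor_le[OF assms(1) clinear_op_id[where 'a = 'e]] by simp
qed

lemma unitary_pair_tensor_id:
  assumes U: "unitary_pair U W"
  shows "unitary_pair (op_tensor U (id_blinfun :: 'e::chilbert_space \<Rightarrow>\<^sub>L 'e)) (op_tensor W id_blinfun)"
proof -
  have id: "id_blinfun o\<^sub>L id_blinfun = (id_blinfun :: 'e \<Rightarrow>\<^sub>L 'e)" by (rule blinfun_eqI) simp
  show ?thesis
    using U by (auto simp: unitary_pair_def inverse_ops_def clinear_op_tensor clinear_op_id norm_tensor_id_le
        op_tensor_compose op_tensor_id id)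
qed

section \<open>The full Fock space and separable Hilbert spaces\<close>

definition fock_basis :: "'n list \<Rightarrow> 'n fock" where
  "fock_basis \<alpha> = Abs_ell2 (\<lambda>\<beta>. if \<beta> = \<alpha> then 1 else 0)"

lemma ell2_fun_fock_basis: "ell2_fun (fock_basis \<alpha>) \<beta> = (if \<beta> = \<alpha> then 1 else 0)"
proof -
  have "(\<lambda>\<beta>. (norm (if \<beta> = \<alpha> then 1 else 0 :: complex))\<^sup>2) summable_on UNIV"
    by (rule finite_nonzero_values_imp_summable_on) (rule finite_subset[of _ "{\<alpha>}"], auto)
  then show ?thesis unfolding fock_basis_def by (subst ell2_funI) auto
qed

lemma cinner_fock_basis: "cinner \<phi> (fock_basis \<alpha>) = ell2_fun \<phi> \<alpha>"
  unfolding cinner_ell2_def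
  by (rule infsumI, rule has_sum_finite_neutralI[of "{\<alpha>}"])
    (auto simp: ell2_fun_fock_basis cinner_complex_def)

lemma is_onb_fock_basis: "is_onb (range fock_basis)"
  unfolding is_onb_def orthonormal_def
proof (intro conjI ballI allI impI)
  fix a b :: "'a fock" assume "a \<in> range fock_basis" "b \<in> range fock_basis"
  then obtain \<alpha> \<beta> where ab: "a = fock_basis \<alpha>" "b = fock_basis \<beta>" by blast
  have "\<alpha> = \<beta>" if "fock_basis \<alpha> = fock_basis \<beta>"
    using ell2_fun_fock_basis[of \<alpha> \<alpha>] ell2_fun_fock_basis[of \<beta> \<alpha>] that by (auto split: if_splits)
  then show "cinner a b = (if a = b then 1 else 0)"
    by (auto simp: ab cinner_fock_basis ell2_fun_fock_basis)
next
  fix x :: "'a fock" assume "\<forall>b\<in>range fock_basis. cinner x b = 0"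
  then show "x = 0" by (intro ell2_eqI) (simp add: cinner_fock_basis ell2_fun_zero)
qed

lemma inj_fock_basis: "inj fock_basis"
proof (rule injI)
  fix \<alpha> \<beta> :: "'a list" assume "fock_basis \<alpha> = fock_basis \<beta>"
  then show "\<alpha> = \<beta>"
    using ell2_fun_fock_basis[of \<alpha> \<alpha>] ell2_fun_fock_basis[of \<beta> \<alpha>] by (auto split: if_splits)
qed

text \<open>
  Distinct vectors of an orthonormal set are at distance \<open>\<surd>2\<close>, so choosing a point of a dense set
  within \<open>1/2\<close> of each of them is injective.
\<close>

lemma orthonormal_countable:
  fixes B D :: "'a::chilbert_space set"
  assumes D: "countable D" "closure D = UNIV" and B: "orthonormal B"
  shows "countable B"
proof -
  have "\<exists>d\<in>D. dist d b < 1/2" for b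
    using D(2) closure_approachable[of b D] by (metis UNIV_I half_gt_zero_iff zero_less_one)
  then obtain f where f: "\<And>b. f b \<in> D" "\<And>b. dist (f b) b < 1/2" by metis
  have "inj_on f B"
  proof (rule inj_onI, rule ccontr)
    fix a b assume ab: "a \<in> B" "b \<in> B" "f a = f b" "a \<noteq> b"
    then have "cinner (a - b) (a - b) = 2"
      using B by (simp add: orthonormal_def cinner_diff_left cinner_diff_right)
    then have "complex_of_real ((norm (a - b))\<^sup>2) = complex_of_real 2" by (simp add: cinner_self)
    then have *: "(norm (a - b))\<^sup>2 = 2" by (simp only: of_real_eq_iff)
    have "norm (a - b) < 1"
      using f(2)[of a] f(2)[of b] ab(3) dist_triangle_half_r[of "f a" a 1 b] by (simp add: dist_norm)
    then have "(norm (a - b))\<^sup>2 \<le> 1\<^sup>2" by (intro power_mono) auto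
    with * show False by simp
  qed
  moreover have "countable (f ` B)" using D(1) f(1) by (auto intro: countable_subset)
  ultimately show ?thesis by (rule countable_image_inj_on[rotated])
qed

text \<open>The span is the real one, so a basis \<open>B\<close> has to be completed by \<open>\<i> B\<close>.\<close>

lemma finite_onb_imp_finite_span:
  fixes B :: "'a::chilbert_space set"
  assumes "is_onb B" "finite B"
  shows "\<exists>C::'a set. finite C \<and> span C = UNIV"
proof (intro exI conjI)
  let ?C = "B \<union> (\<lambda>b. \<i> *\<^sub>C b) ` B"
  show "finite ?C" using assms by simp
  have "x \<in> span ?C" for x
  proof -
    have "c *\<^sub>C b \<in> span ?C" if "b \<in> B" for c b
    proof -
      have "c *\<^sub>C b = complex_of_real (Re c) *\<^sub>C b + complex_of_real (Im c) *\<^sub>C (\<i> *\<^sub>C b)"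
        unfolding scaleC_scaleC scaleC_add_left[symmetric]
        by (rule arg_cong[of _ _ "\<lambda>c. c *\<^sub>C b"]) (simp add: complex_eq_iff)
      also have "\<dots> = Re c *\<^sub>R b + Im c *\<^sub>R (\<i> *\<^sub>C b)" by (simp only: scaleC_of_real)
      also have "\<dots> \<in> span ?C" by (intro span_add span_scale span_base) (use that in auto)
      finally show ?thesis .
    qed
    then have "(\<Sum>a\<in>B. cinner x a *\<^sub>C a) \<in> span ?C" by (intro span_sum)
    moreover have "x = (\<Sum>a\<in>B. cinner x a *\<^sub>C a)"
      using has_sum_unique[OF onb_expansion[OF assms(1), of x] has_sum_finite[OF assms(2)]] .
    ultimately show ?thesis by simp
  qed
  then show "span ?C = UNIV" by auto
qed

lemma fock_unitary_exists:
  assumes "\<exists>D::'h::chilbert_space set. countable D \<and> closure D = UNIV"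
    and "\<nexists>B::'h::chilbert_space set. finite B \<and> span B = UNIV"
  obtains U :: "'n::countable fock \<Rightarrow>\<^sub>L 'h::chilbert_space" and W where "unitary_pair U W"
proof -
  let ?B = "range (fock_basis :: 'n list \<Rightarrow> _)" and ?B' = "onb :: 'h set"
  have "countable ?B'"
    using assms(1) is_onb_onb[where 'a = 'h] orthonormal_countable unfolding is_onb_def by metis
  moreover have "infinite ?B'" using assms(2) finite_onb_imp_finite_span[OF is_onb_onb] by blast
  ultimately have w': "bij_betw (from_nat_into ?B') UNIV ?B'" by (rule bij_betw_from_nat_into)
  have "infinite ?B" using inj_fock_basis finite_imageD infinite_UNIV_listI by blast
  then have w: "bij_betw (to_nat_on ?B) ?B UNIV" by (intro to_nat_on_infinite) auto
  show thesis
    by (rule unitary_of_bij_onb[OF is_onb_fock_basis is_onb_onb bij_betw_trans[OF w w']]) (rule that)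
qed

section \<open>The row of creation operators\<close>

lemma clinear_creation: "clinear_op (creation i)"
  by (rule clinear_opI, rule ell2_eqI)
    (simp add: creation_apply ell2_fun_creation_fun ell2_fun_scaleC split: list.split)

lemma creation_fock_basis: "blinfun_apply (creation i) (fock_basis \<alpha>) = fock_basis (i # \<alpha>)"
  by (rule ell2_eqI)
    (auto simp: creation_apply ell2_fun_creation_fun ell2_fun_fock_basis split: list.split)

lemma ell2_fun_adj_creation: "ell2_fun (blinfun_apply (adj (creation i)) \<phi>) \<alpha> = ell2_fun \<phi> (i # \<alpha>)"
  using cinner_adj[OF clinear_creation, of i "fock_basis \<alpha>" \<phi>]
  by (metis cinner_commute cinner_fock_basis creation_fock_basis)

lemma ell2_fun_creation_adj:
  "ell2_fun (blinfun_apply (creation i) (blinfun_apply (adj (creation i)) \<phi>)) \<alpha> =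
     (if \<alpha> \<noteq> [] \<and> hd \<alpha> = i then ell2_fun \<phi> \<alpha> else 0)"
  by (simp add: creation_apply ell2_fun_creation_fun ell2_fun_adj_creation split: list.split)

lemma ell2_fun_sum: "ell2_fun (\<Sum>i\<in>F. f i) \<alpha> = (\<Sum>i\<in>F. ell2_fun (f i) \<alpha>)"
  by (induction F rule: infinite_finite_induct) (simp_all add: ell2_fun_zero ell2_fun_add)

definition off_vacuum :: "'n fock \<Rightarrow> 'n fock" where
  "off_vacuum \<phi> = \<phi> - ell2_fun \<phi> [] *\<^sub>C fock_basis []"

lemma ell2_fun_off_vacuum: "ell2_fun (off_vacuum \<phi>) \<alpha> = (if \<alpha> = [] then 0 else ell2_fun \<phi> \<alpha>)"
  by (simp add: off_vacuum_def ell2_fun_diff ell2_fun_scaleC ell2_fun_fock_basis scaleC_complex_def)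

lemma norm_off_vacuum_le: "norm (off_vacuum \<phi>) \<le> norm \<phi>"
proof (rule ell2_norm_leI)
  fix A :: "'a list set" assume A: "finite A"
  have "(\<Sum>\<alpha>\<in>A. (norm (ell2_fun (off_vacuum \<phi>) \<alpha>))\<^sup>2) \<le> (\<Sum>\<alpha>\<in>A. (norm (ell2_fun \<phi> \<alpha>))\<^sup>2)"
    by (rule sum_mono) (simp add: ell2_fun_off_vacuum)
  also have "\<dots> \<le> (norm \<phi>)\<^sup>2" by (rule ell2_finite_sum_le[OF A])
  finally show "(\<Sum>\<alpha>\<in>A. (norm (ell2_fun (off_vacuum \<phi>) \<alpha>))\<^sup>2) \<le> (norm \<phi>)\<^sup>2" .
qed simp

lemma bounded_linear_off_vacuum: "bounded_linear off_vacuum"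
  by (rule bounded_linear_intro[where K = 1])
    (auto intro!: ell2_eqI norm_off_vacuum_le simp: ell2_fun_off_vacuum ell2_fun_add ell2_fun_scaleR)

text \<open>
  The projections \<open>S\<^sub>i S\<^sub>i\<^sup>*\<close> split the words by their first letter, so finitely many of them capture
  all but a small part of the square norm of a vector without vacuum component.
\<close>

lemma creation_row_has_sum:
  "((\<lambda>i. blinfun_apply (creation i) (blinfun_apply (adj (creation i)) \<phi>)) has_sum off_vacuum \<phi>) UNIV"
  unfolding has_sum_def
proof (rule tendstoI)
  fix e :: real assume e: "0 < e"
  let ?S = "\<lambda>i. blinfun_apply (creation i) (blinfun_apply (adj (creation i)) \<phi>)"
  let ?q = "\<lambda>\<alpha>. (norm (ell2_fun \<phi> \<alpha>))\<^sup>2"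
  obtain D where D: "finite D" "dist (sum ?q D) (infsum ?q UNIV) \<le> (e / 2)\<^sup>2"
    using infsum_finite_approximation[OF ell2_summable[of \<phi>], of "(e / 2)\<^sup>2"] e by auto
  have "dist (sum ?S F) (off_vacuum \<phi>) < e" if F: "finite F" "hd ` D \<subseteq> F" for F
  proof -
    have coord: "norm (ell2_fun (sum ?S F - off_vacuum \<phi>) \<alpha>) \<le> (if \<alpha> \<in> D then 0 else norm (ell2_fun \<phi> \<alpha>))" for \<alpha>
    proof -
      have "ell2_fun (sum ?S F) \<alpha> = (\<Sum>i\<in>F. if i = hd \<alpha> then (if \<alpha> \<noteq> [] then ell2_fun \<phi> \<alpha> else 0) else 0)"
        unfolding ell2_fun_sum ell2_fun_creation_adj by (rule sum.cong) auto
      also have "\<dots> = (if hd \<alpha> \<in> F \<and> \<alpha> \<noteq> [] then ell2_fun \<phi> \<alpha> else 0)"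
        using F(1) by simp
      finally show ?thesis using F(2) by (auto simp: ell2_fun_diff ell2_fun_off_vacuum)
    qed
    have "norm (sum ?S F - off_vacuum \<phi>) \<le> e / 2"
    proof (rule ell2_norm_leI)
      fix A :: "'a list set" assume A: "finite A"
      have "(\<Sum>\<alpha>\<in>A. (norm (ell2_fun (sum ?S F - off_vacuum \<phi>) \<alpha>))\<^sup>2) \<le> (\<Sum>\<alpha>\<in>A. if \<alpha> \<in> D then 0 else ?q \<alpha>)"
      proof (rule sum_mono)
        fix \<alpha>
        show "(norm (ell2_fun (sum ?S F - off_vacuum \<phi>) \<alpha>))\<^sup>2 \<le> (if \<alpha> \<in> D then 0 else ?q \<alpha>)"
          using power_mono[OF coord[of \<alpha>] norm_ge_zero, of 2] by (cases "\<alpha> \<in> D") auto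
      qed
      also have "\<dots> = sum ?q (A - D)"
        using A by (intro sum.mono_neutral_cong_right) auto
      also have "\<dots> = sum ?q (A \<union> D) - sum ?q D"
        using A D(1) sum_diff[of "A \<union> D" D ?q] by (simp add: Un_Diff)
      also have "sum ?q (A \<union> D) \<le> infsum ?q UNIV"
        by (rule finite_sum_le_infsum) (use D A in \<open>auto intro: ell2_summable\<close>)
      finally show "(\<Sum>\<alpha>\<in>A. (norm (ell2_fun (sum ?S F - off_vacuum \<phi>) \<alpha>))\<^sup>2) \<le> (e / 2)\<^sup>2"
        using D(2) unfolding dist_real_def by linarith
    qed (use e in simp)
    then show ?thesis using e by (simp add: dist_norm)
  qed
  then show "\<forall>\<^sub>F F in finite_subsets_at_top UNIV. dist (sum ?S F) (off_vacuum \<phi>) < e"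
    unfolding eventually_finite_subsets_at_top using D(1) by (intro exI[of _ "hd ` D"]) auto
qed

lemma cinner_scaleR_left: "cinner (r *\<^sub>R x) y = complex_of_real r * cinner x y"
  by (simp add: cinner_scaleC_left flip: scaleC_of_real)

lemma cinner_scaleR_right: "cinner x (r *\<^sub>R y) = complex_of_real r * cinner x y"
  by (simp add: cinner_scaleC_right flip: scaleC_of_real)

text \<open>
  For the row \<open>(rS\<^sub>1, rS\<^sub>2, \<dots>)\<close> the sum \<open>\<Sum>\<^sub>i X\<^sub>i X\<^sub>i\<^sup>*\<close> is \<open>r\<^sup>2\<close> times the projection off the vacuum, and
  conjugation by a unitary preserves this.
\<close>

lemma unitary_creation_row_ball:
  fixes U :: "'n::countable fock \<Rightarrow>\<^sub>L 'h::chilbert_space"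
  assumes U: "unitary_pair U W" and r: "0 < r" "r < 1"
  shows "(\<lambda>i. U o\<^sub>L (r *\<^sub>R creation i) o\<^sub>L W) \<in> row_ball"
proof -
  define X where "X i = U o\<^sub>L (r *\<^sub>R creation i) o\<^sub>L W" for i
  have clin: "clinear_op U" "clinear_op W" and norms: "norm U \<le> 1" "norm W \<le> 1"
    using U by (simp_all add: unitary_pair_def)
  have adjX: "adj (X i) = U o\<^sub>L (r *\<^sub>R adj (creation i)) o\<^sub>L W" for i
  proof (rule adj_unique)
    fix x y
    have "cinner (blinfun_apply (X i) x) y =
        cinner (r *\<^sub>R blinfun_apply (creation i) (blinfun_apply W x)) (blinfun_apply W y)"
      by (simp add: X_def unitary_pair_cinner[OF U] blinfun.scaleR_left)
    also have "\<dots> = cinner (blinfun_apply W x) (r *\<^sub>R blinfun_apply (adj (creation i)) (blinfun_apply W y))"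
      by (simp add: cinner_scaleR_left cinner_scaleR_right cinner_adj[OF clinear_creation])
    also have "\<dots> = cinner x (blinfun_apply (U o\<^sub>L (r *\<^sub>R adj (creation i)) o\<^sub>L W) y)"
      by (simp add: unitary_pair_cinner[OF unitary_pair_sym[OF U]] blinfun.scaleR_left)
    finally show "cinner (blinfun_apply (X i) x) y =
        cinner x (blinfun_apply (U o\<^sub>L (r *\<^sub>R adj (creation i)) o\<^sub>L W) y)" .
  qed
  have XX: "blinfun_apply (X i o\<^sub>L adj (X i)) x =
      r\<^sup>2 *\<^sub>R blinfun_apply U (blinfun_apply (creation i) (blinfun_apply (adj (creation i)) (blinfun_apply W x)))" for i x
    unfolding adjX
    by (simp add: X_def blinfun.scaleR_left blinfun.scaleR_right unitary_pair_apply[OF U] power2_eq_square)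
  define P where "P = r\<^sup>2 *\<^sub>R (U o\<^sub>L Blinfun off_vacuum o\<^sub>L W)"
  have "row_square X P"
    unfolding row_square_def
  proof
    fix x
    have "((\<lambda>i. r\<^sup>2 *\<^sub>R blinfun_apply U (blinfun_apply (creation i) (blinfun_apply (adj (creation i)) (blinfun_apply W x))))
        has_sum r\<^sup>2 *\<^sub>R blinfun_apply U (off_vacuum (blinfun_apply W x))) UNIV"
      by (rule has_sum_bounded_linear[OF _ creation_row_has_sum]) (intro bounded_linear_intros)
    then show "((\<lambda>i. blinfun_apply (X i o\<^sub>L adj (X i)) x) has_sum blinfun_apply P x) UNIV"
      unfolding XX
      by (simp add: P_def blinfun.scaleR_left bounded_linear_Blinfun_apply[OF bounded_linear_off_vacuum])
  qed
  moreover have "norm P < 1"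
  proof -
    have "norm (Blinfun off_vacuum :: 'n fock \<Rightarrow>\<^sub>L 'n fock) \<le> 1"
      by (rule norm_blinfun_bound)
        (auto simp: bounded_linear_Blinfun_apply[OF bounded_linear_off_vacuum] norm_off_vacuum_le)
    then have "norm (U o\<^sub>L Blinfun off_vacuum o\<^sub>L W) \<le> 1 * 1 * 1"
      by (intro norm_compose_le norms)
    then have "norm P \<le> r\<^sup>2" by (simp add: P_def mult_left_le)
    also have "\<dots> < 1" using r by (simp add: power_less_one_iff)
    finally show ?thesis .
  qed
  moreover have "clinear_op (X i)" for i
    unfolding X_def by (intro clinear_op_compose clinear_op_scaleR clinear_creation clin)
  ultimately have "X \<in> row_ball" unfolding row_ball_def by auto
  then show ?thesis by (simp add: X_def[abs_def])
qed

section \<open>Unitary invariance of free power series\<close>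

lemma clinear_word_op: "(\<And>i. clinear_op (X i)) \<Longrightarrow> clinear_op (word_op X \<alpha>)"
  by (induction \<alpha>) (simp_all add: clinear_op_id clinear_op_compose)

lemma word_op_unitary:
  assumes U: "unitary_pair U W"
  shows "word_op (\<lambda>i. U o\<^sub>L Y i o\<^sub>L W) \<alpha> = U o\<^sub>L word_op Y \<alpha> o\<^sub>L W"
  by (induction \<alpha>) (auto intro!: blinfun_eqI simp: unitary_pair_apply[OF U])

text \<open>
  Each term satisfies \<open>Y\<^sub>\<alpha> \<otimes> A\<^sub>\<alpha> = (W \<otimes> I) (X\<^sub>\<alpha> \<otimes> A\<^sub>\<alpha>) (U \<otimes> I)\<close>, and multiplication by fixed operators on
  both sides is continuous for the strong sums as well as for the norm convergent series.
\<close>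

lemma free_series_sum_unitary:
  fixes U :: "'h::chilbert_space \<Rightarrow>\<^sub>L 'k::chilbert_space"
    and A :: "'n::countable list \<Rightarrow> ('e::chilbert_space \<Rightarrow>\<^sub>L 'g::chilbert_space)"
  assumes U: "unitary_pair U W" and A: "\<And>\<alpha>. clinear_op (A \<alpha>)" and Y: "\<And>i. clinear_op (Y i)"
    and sum: "free_series_sum A (\<lambda>i. U o\<^sub>L Y i o\<^sub>L W) T"
  shows "free_series_sum A Y (op_tensor W id_blinfun o\<^sub>L T o\<^sub>L op_tensor U id_blinfun)"
proof -
  let ?X = "\<lambda>i. U o\<^sub>L Y i o\<^sub>L W"
  have clin: "clinear_op U" "clinear_op W" using U by (simp_all add: unitary_pair_def)
  let ?L = "op_tensor W (id_blinfun :: 'g \<Rightarrow>\<^sub>L 'g)" and ?R = "op_tensor U (id_blinfun :: 'e \<Rightarrow>\<^sub>L 'e)"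
  obtain H where H: "\<And>k x. ((\<lambda>\<alpha>. blinfun_apply (op_tensor (word_op ?X \<alpha>) (A \<alpha>)) x)
      has_sum blinfun_apply (H k) x) {\<alpha>. length \<alpha> = k}" "H sums T"
    using sum unfolding free_series_sum_def by blast
  have clinX: "clinear_op (?X i)" for i by (intro clinear_op_compose clin Y)
  have conj: "op_tensor (word_op Y \<alpha>) (A \<alpha>) = ?L o\<^sub>L op_tensor (word_op ?X \<alpha>) (A \<alpha>) o\<^sub>L ?R" for \<alpha>
    by (rule blinfun_eq_on_tensor)
      (simp add: op_tensor_apply clin clinear_op_id A clinear_word_op[OF Y] clinear_word_op[OF clinX]
        word_op_unitary[OF U] unitary_pair_apply[OF U] clinear_op_compose)
  have "((\<lambda>\<alpha>. blinfun_apply (op_tensor (word_op Y \<alpha>) (A \<alpha>)) x)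
      has_sum blinfun_apply (?L o\<^sub>L H k o\<^sub>L ?R) x) {\<alpha>. length \<alpha> = k}" for k x
    using has_sum_bounded_linear[OF blinfun.bounded_linear_right H(1), of ?L "blinfun_apply ?R x" k]
    by (simp add: conj)
  moreover have "(\<lambda>k. ?L o\<^sub>L H k o\<^sub>L ?R) sums (?L o\<^sub>L T o\<^sub>L ?R)"
    by (intro bounded_linear.sums[OF bounded_bilinear.bounded_linear_left[OF bounded_bilinear_blinfun_compose]]
        bounded_linear.sums[OF bounded_bilinear.bounded_linear_right[OF bounded_bilinear_blinfun_compose]] H(2))
  ultimately show ?thesis unfolding free_series_sum_def by (intro exI[of _ "\<lambda>k. ?L o\<^sub>L H k o\<^sub>L ?R"]) auto
qed

lemma free_eval_eq:
  assumes "free_series_sum A X T"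
  shows "free_eval A X = T"
  unfolding free_eval_def
proof (rule the_equality)
  fix T' assume "free_series_sum A X T'"
  then obtain H H' where "H sums T" "H' sums T'"
    and H: "\<And>k x. ((\<lambda>\<alpha>. blinfun_apply (op_tensor (word_op X \<alpha>) (A \<alpha>)) x)
      has_sum blinfun_apply (H k) x) {\<alpha>. length \<alpha> = k}"
    and H': "\<And>k x. ((\<lambda>\<alpha>. blinfun_apply (op_tensor (word_op X \<alpha>) (A \<alpha>)) x)
      has_sum blinfun_apply (H' k) x) {\<alpha>. length \<alpha> = k}"
    using assms unfolding free_series_sum_def by blast
  moreover have "H = H'" by (intro ext blinfun_eqI has_sum_unique[OF H H'])
  ultimately show "T' = T" using sums_unique2 by blast
qed (rule assms)

text \<open>
  The unitary moves \<open>(rS\<^sub>1, rS\<^sub>2, \<dots>)\<close> into the ball on which \<open>F\<close> is given, where convergence of the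
  series is part of being free holomorphic. In particular the series converges at
  \<open>(rS\<^sub>1, rS\<^sub>2, \<dots>)\<close>.
\<close>

lemma eval_radial_unitary:
  fixes F :: "('n::countable \<Rightarrow> ('h::chilbert_space \<Rightarrow>\<^sub>L 'h)) \<Rightarrow>
      (('h, 'e::chilbert_space) htensor \<Rightarrow>\<^sub>L ('h, 'g::chilbert_space) htensor)"
  assumes U: "unitary_pair U W" and F: "free_holomorphic F A" and r: "0 < r" "r < 1"
  shows "eval_radial A r = op_tensor W id_blinfun o\<^sub>L
    F (\<lambda>i. U o\<^sub>L (r *\<^sub>R creation i) o\<^sub>L W) o\<^sub>L op_tensor U id_blinfun"
  unfolding eval_radial_def
proof (rule free_eval_eq, rule free_series_sum_unitary[OF U])
  show "free_series_sum A (\<lambda>i. U o\<^sub>L (r *\<^sub>R creation i) o\<^sub>L W) (F (\<lambda>i. U o\<^sub>L (r *\<^sub>R creation i) o\<^sub>L W))"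
    using F unitary_creation_row_ball[OF U r] unfolding free_holomorphic_def by blast
  show "clinear_op (A \<alpha>)" for \<alpha> using F by (simp add: free_holomorphic_def)
  show "clinear_op (r *\<^sub>R creation i)" for i by (intro clinear_op_scaleR clinear_creation)
qed

lemma eval_radial_bounded:
  fixes F :: "('n::countable \<Rightarrow> ('h::chilbert_space \<Rightarrow>\<^sub>L 'h)) \<Rightarrow>
      (('h, 'e::chilbert_space) htensor \<Rightarrow>\<^sub>L ('h, 'g::chilbert_space) htensor)"
    and U :: "'n fock \<Rightarrow>\<^sub>L 'h"
  assumes U: "unitary_pair U W" and F: "free_holomorphic F A" and bdd: "bounded (F ` row_ball)"
    and r: "0 < r" "r < 1"
  shows "clinear_op (eval_radial A r)" "norm (eval_radial A r) \<le> sup_norm F"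
proof -
  let ?X = "\<lambda>i. U o\<^sub>L (r *\<^sub>R creation i) o\<^sub>L W"
  have X: "?X \<in> row_ball" by (rule unitary_creation_row_ball[OF U r])
  have clin: "clinear_op U" "clinear_op W" and norms: "norm U \<le> 1" "norm W \<le> 1"
    using U by (simp_all add: unitary_pair_def)
  have "clinear_op (F ?X)"
    using F X unfolding free_holomorphic_def by (blast intro: spatial_tensor_clinear)
  then show "clinear_op (eval_radial A r)"
    unfolding eval_radial_unitary[OF U F r]
    by (intro clinear_op_compose clinear_op_tensor clinear_op_id clin)
  have "bdd_above ((\<lambda>X. norm (F X)) ` row_ball)"
  proof -
    obtain M where "\<And>X. X \<in> row_ball \<Longrightarrow> norm (F X) \<le> M" using bdd unfolding bounded_iff by blast
    then show ?thesis by (rule bdd_aboveI2)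
  qed
  then have "norm (F ?X) \<le> sup_norm F" unfolding sup_norm_def by (rule cSUP_upper[OF X])
  then have "norm (eval_radial A r) \<le> 1 * sup_norm F * 1"
    unfolding eval_radial_unitary[OF U F r]
    by (intro norm_compose_le norm_tensor_id_le norms clin)
  then show "norm (eval_radial A r) \<le> sup_norm F" by simp
qed

section \<open>Lower bounds and the operator \<open>T\<^sup>*T\<close>\<close>

lemma cinner_gram:
  assumes "clinear_op T"
  shows "cinner (blinfun_apply (adj T o\<^sub>L T) x) y = cinner (blinfun_apply T x) (blinfun_apply T y)"
  using cinner_adj[OF assms, of y "blinfun_apply T x"] by (metis blinfun_apply_blinfun_compose cinner_commute)

lemma inner_gram:
  assumes "clinear_op T"
  shows "inner (blinfun_apply (adj T o\<^sub>L T) x) y = inner (blinfun_apply T x) (blinfun_apply T y)"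
  using cinner_gram[OF assms, of x y] by (metis Re_cinner)

lemma norm_gram_le:
  assumes "clinear_op T" "norm T \<le> 1"
  shows "norm (adj T o\<^sub>L T) \<le> 1"
  using norm_compose_le[OF order.trans[OF norm_adj_le[OF assms(1)] assms(2)] assms(2)] by simp

lemma op_ge_gram_iff:
  assumes T: "clinear_op T"
  shows "op_ge (adj T o\<^sub>L T) (c *\<^sub>R id_blinfun) \<longleftrightarrow>
    (\<forall>x. c * (norm x)\<^sup>2 \<le> (norm (blinfun_apply T x))\<^sup>2)"
proof -
  have "cinner (blinfun_apply ((adj T o\<^sub>L T) - c *\<^sub>R id_blinfun) x) x =
      complex_of_real ((norm (blinfun_apply T x))\<^sup>2 - c * (norm x)\<^sup>2)" for x
    using cinner_gram[OF T, of x x]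
    by (simp add: blinfun.diff_left blinfun.scaleR_left cinner_diff_left cinner_scaleR_left cinner_self)
  then show ?thesis unfolding op_ge_def pos_op_def by (simp only: of_real_eq_iff) auto
qed

lemma min_modulus_sq_ge_iff:
  fixes T :: "'a::chilbert_space \<Rightarrow>\<^sub>L 'b::chilbert_space"
  assumes unit: "\<exists>x::'a. norm x = 1"
  shows "c \<le> (min_modulus T)\<^sup>2 \<longleftrightarrow> (\<forall>x. c * (norm x)\<^sup>2 \<le> (norm (blinfun_apply T x))\<^sup>2)"
proof
  have bdd: "bdd_below ((\<lambda>x. norm (blinfun_apply T x)) ` {x. norm x = 1})"
    by (rule bdd_belowI2[of _ 0]) simp
  have ne: "{x::'a. norm x = 1} \<noteq> {}" using unit by auto
  have m0: "0 \<le> min_modulus T" unfolding min_modulus_def by (rule cINF_greatest[OF ne]) simp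
  show "\<forall>x. c * (norm x)\<^sup>2 \<le> (norm (blinfun_apply T x))\<^sup>2" if c: "c \<le> (min_modulus T)\<^sup>2"
  proof
    fix x :: 'a
    have "min_modulus T * norm x \<le> norm (blinfun_apply T x)"
    proof (cases "x = 0")
      case False
      have "min_modulus T \<le> norm (blinfun_apply T (inverse (norm x) *\<^sub>R x))"
        unfolding min_modulus_def by (rule cINF_lower[OF bdd]) (use False in simp)
      then show ?thesis using False by (simp add: blinfun.scaleR_right field_simps)
    qed simp
    then have "(min_modulus T * norm x)\<^sup>2 \<le> (norm (blinfun_apply T x))\<^sup>2"
      using m0 by (intro power_mono) auto
    moreover have "c * (norm x)\<^sup>2 \<le> (min_modulus T)\<^sup>2 * (norm x)\<^sup>2" using c by (rule mult_right_mono) simp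
    ultimately show "c * (norm x)\<^sup>2 \<le> (norm (blinfun_apply T x))\<^sup>2" by (simp add: power_mult_distrib)
  qed
  show "c \<le> (min_modulus T)\<^sup>2" if c: "\<forall>x. c * (norm x)\<^sup>2 \<le> (norm (blinfun_apply T x))\<^sup>2"
  proof (cases "0 \<le> c")
    case True
    have "sqrt c \<le> min_modulus T"
      unfolding min_modulus_def
    proof (rule cINF_greatest[OF ne])
      fix x :: 'a assume "x \<in> {x. norm x = 1}"
      then show "sqrt c \<le> norm (blinfun_apply T x)" using c[rule_format, of x] by (simp add: real_le_lsqrt)
    qed
    then have "(sqrt c)\<^sup>2 \<le> (min_modulus T)\<^sup>2" using True by (intro power_mono) auto
    then show ?thesis using True by simp
  qed (simp add: order.trans[of c 0])
qed

lemma min_modulus_bounds: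
  fixes T :: "'a::chilbert_space \<Rightarrow>\<^sub>L 'b::chilbert_space"
  assumes unit: "\<exists>x::'a. norm x = 1" and T: "norm T \<le> 1"
  shows "0 \<le> min_modulus T" "min_modulus T \<le> 1"
proof -
  obtain x :: 'a where x: "norm x = 1" using unit by blast
  show m0: "0 \<le> min_modulus T"
    unfolding min_modulus_def using x by (intro cINF_greatest) auto
  have "(min_modulus T)\<^sup>2 \<le> (norm (blinfun_apply T x))\<^sup>2"
    using min_modulus_sq_ge_iff[OF unit, of "(min_modulus T)\<^sup>2" T] x by (metis mult.right_neutral one_power2 order.refl)
  then have "min_modulus T \<le> norm (blinfun_apply T x)" by (rule power2_le_imp_le) simp
  also have "\<dots> \<le> 1" using norm_apply_le_of_contraction[OF T, of x] x by simp
  finally show "min_modulus T \<le> 1" .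
qed

text \<open>
  For a contraction \<open>T\<close> and \<open>P = T\<^sup>*T\<close>,
  \<open>\<parallel>x - P x\<parallel>\<^sup>2 = \<parallel>x\<parallel>\<^sup>2 - 2 \<parallel>T x\<parallel>\<^sup>2 + \<parallel>P x\<parallel>\<^sup>2 \<le> \<parallel>x\<parallel>\<^sup>2 - \<parallel>T x\<parallel>\<^sup>2 \<le> (1 - c) \<parallel>x\<parallel>\<^sup>2\<close>.
  So \<open>x \<mapsto> y + x - P x\<close> is a strict contraction, and its fixed point solves \<open>P x = y\<close>.
\<close>

lemma gram_invertible:
  fixes T :: "'a::chilbert_space \<Rightarrow>\<^sub>L 'b::chilbert_space"
  assumes T: "clinear_op T" "norm T \<le> 1" and c: "0 < c"
    and lower: "\<And>x. c * (norm x)\<^sup>2 \<le> (norm (blinfun_apply T x))\<^sup>2"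
  obtains Q where "inverse_ops (adj T o\<^sub>L T) Q" "norm Q \<le> inverse c"
proof -
  define P where "P = adj T o\<^sub>L T"
  have inner_P: "inner (blinfun_apply P x) y = inner (blinfun_apply T x) (blinfun_apply T y)" for x y
    unfolding P_def by (rule inner_gram[OF T(1)])
  have contr: "norm (x - blinfun_apply P x) \<le> sqrt (max 0 (1 - c)) * norm x" for x
  proof -
    have "norm (blinfun_apply P x) \<le> norm (blinfun_apply T x)"
      unfolding P_def using norm_apply_le_of_contraction[OF order.trans[OF norm_adj_le[OF T(1)] T(2)]] by simp
    then have "(norm (blinfun_apply P x))\<^sup>2 \<le> (norm (blinfun_apply T x))\<^sup>2" by (intro power_mono) auto
    moreover have "(norm (x - blinfun_apply P x))\<^sup>2 =
        (norm x)\<^sup>2 - 2 * (norm (blinfun_apply T x))\<^sup>2 + (norm (blinfun_apply P x))\<^sup>2"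
      using inner_P[of x x] by (simp add: power2_norm_eq_inner inner_diff_left inner_diff_right inner_commute)
    ultimately have "(norm (x - blinfun_apply P x))\<^sup>2 \<le> (1 - c) * (norm x)\<^sup>2"
      using lower[of x] unfolding left_diff_distrib mult_1_left by linarith
    also have "\<dots> \<le> max 0 (1 - c) * (norm x)\<^sup>2" by (rule mult_right_mono) auto
    finally have "(norm (x - blinfun_apply P x))\<^sup>2 \<le> (sqrt (max 0 (1 - c)) * norm x)\<^sup>2"
      by (simp add: power_mult_distrib)
    then show ?thesis by (rule power2_le_imp_le) simp
  qed
  have expand: "c * norm x \<le> norm (blinfun_apply P x)" for x
  proof (cases "x = 0")
    case False
    have "c * (norm x)\<^sup>2 \<le> inner (blinfun_apply P x) x"
      using lower[of x] by (simp add: inner_P power2_norm_eq_inner)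
    also have "\<dots> \<le> norm (blinfun_apply P x) * norm x" by (rule norm_cauchy_schwarz)
    finally show ?thesis using False by (simp add: power2_eq_square)
  qed simp
  have inj: "x = y" if "blinfun_apply P x = blinfun_apply P y" for x y
    using expand[of "x - y"] that c by (simp add: blinfun.diff_right mult_le_0_iff)
  have "\<exists>x. blinfun_apply P x = y" for y
  proof -
    have "\<exists>!x. y + (x - blinfun_apply P x) = x"
    proof (rule banach_fix_type[where c = "sqrt (max 0 (1 - c))"])
      show "\<forall>x z. dist (y + (x - blinfun_apply P x)) (y + (z - blinfun_apply P z)) \<le> sqrt (max 0 (1 - c)) * dist x z"
      proof (intro allI)
        fix x z
        have eq: "y + (x - blinfun_apply P x) - (y + (z - blinfun_apply P z)) = (x - z) - blinfun_apply P (x - z)"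
          by (simp add: blinfun.diff_right)
        show "dist (y + (x - blinfun_apply P x)) (y + (z - blinfun_apply P z)) \<le> sqrt (max 0 (1 - c)) * dist x z"
          using contr[of "x - z"] by (simp only: dist_norm eq)
      qed
    qed (use c in auto)
    then obtain x where "y + (x - blinfun_apply P x) = x" by blast
    then have "blinfun_apply P x = y" by (simp add: algebra_simps)
    then show ?thesis by blast
  qed
  then obtain q where q: "\<And>y. blinfun_apply P (q y) = y" by metis
  have bd: "norm (q y) \<le> norm y * inverse c" for y
    using expand[of "q y"] c by (simp add: q field_simps)
  have "bounded_linear q"
    by (rule bounded_linear_intro[OF _ _ bd]; rule inj)
      (simp_all add: q blinfun.add_right blinfun.scaleR_right)
  then have app: "blinfun_apply (Blinfun q) = q" by (rule bounded_linear_Blinfun_apply)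
  have "inverse_ops P (Blinfun q)"
    unfolding inverse_ops_def
    by (intro conjI blinfun_eqI; simp add: app q) (rule inj, rule q)
  moreover have "norm (Blinfun q) \<le> inverse c"
    by (rule norm_blinfun_bound) (use bd c in \<open>auto simp: app mult.commute\<close>)
  ultimately show thesis unfolding P_def by (rule that)
qed

text \<open>
  For \<open>Q = (T\<^sup>*T)\<^sup>-\<^sup>1\<close> the identities \<open>\<langle>P x, y\<rangle> = \<langle>T x, T y\<rangle>\<close>, \<open>P = T\<^sup>*T\<close>, give \<open>\<parallel>x\<parallel>\<^sup>2 = \<langle>T Q x, T x\<rangle>\<close> and \<open>\<parallel>T Q x\<parallel>\<^sup>2 = \<langle>x, Q x\<rangle> \<le> \<parallel>Q\<parallel> \<parallel>x\<parallel>\<^sup>2\<close>.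
\<close>

lemma gram_inverse_lower_bound:
  fixes T :: "'a::chilbert_space \<Rightarrow>\<^sub>L 'b::chilbert_space"
  assumes T: "clinear_op T" and Q: "inverse_ops (adj T o\<^sub>L T) Q"
  shows "(norm x)\<^sup>2 \<le> norm Q * (norm (blinfun_apply T x))\<^sup>2"
proof (cases "x = 0")
  case False
  let ?z = "blinfun_apply Q x"
  have PQ: "blinfun_apply (adj T o\<^sub>L T) ?z = x"
    using Q unfolding inverse_ops_def by (metis blinfun_apply_blinfun_compose id_blinfun.rep_eq id_apply)
  have "(norm x)\<^sup>2 = inner (blinfun_apply T ?z) (blinfun_apply T x)"
    using inner_gram[OF T, of ?z x] by (simp only: PQ power2_norm_eq_inner)
  also have "\<dots> \<le> norm (blinfun_apply T ?z) * norm (blinfun_apply T x)" by (rule norm_cauchy_schwarz)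
  finally have "((norm x)\<^sup>2)\<^sup>2 \<le> (norm (blinfun_apply T ?z) * norm (blinfun_apply T x))\<^sup>2"
    by (intro power_mono) auto
  also have "\<dots> = (norm (blinfun_apply T ?z))\<^sup>2 * (norm (blinfun_apply T x))\<^sup>2"
    by (rule power_mult_distrib)
  also have "(norm (blinfun_apply T ?z))\<^sup>2 \<le> norm Q * (norm x)\<^sup>2"
  proof -
    have "(norm (blinfun_apply T ?z))\<^sup>2 = inner x ?z"
      using inner_gram[OF T, of ?z ?z] by (simp only: PQ power2_norm_eq_inner)
    also have "\<dots> \<le> norm x * norm ?z" by (rule norm_cauchy_schwarz)
    also have "\<dots> \<le> norm x * (norm Q * norm x)" by (intro mult_left_mono norm_blinfun) simp
    finally show ?thesis by (simp add: power2_eq_square mult_ac)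
  qed
  finally have "(norm x)\<^sup>2 * (norm x)\<^sup>2 \<le> (norm x)\<^sup>2 * (norm Q * (norm (blinfun_apply T x))\<^sup>2)"
    by (simp add: power2_eq_square[of "(norm x)\<^sup>2"] mult_right_mono mult_ac)
  then show ?thesis by (rule mult_left_le_imp_le) (use False in simp)
qed simp

lemma inv_op_eq:
  assumes "inverse_ops T S"
  shows "inv_op T = S"
  unfolding inv_op_def
proof (rule the_equality)
  fix R assume R: "inverse_ops T R"
  have "R = R o\<^sub>L (T o\<^sub>L S)" using assms unfolding inverse_ops_def by (auto intro: blinfun_eqI)
  also have "\<dots> = (R o\<^sub>L T) o\<^sub>L S" by (auto intro: blinfun_eqI)
  also have "\<dots> = S" using R unfolding inverse_ops_def by (auto intro: blinfun_eqI)
  finally show "R = S" .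
qed (rule assms)

lemma inverse_of_contraction_norm_ge:
  fixes P :: "'a::chilbert_space \<Rightarrow>\<^sub>L 'b::chilbert_space"
  assumes unit: "\<exists>x::'a. norm x = 1" and P: "norm P \<le> 1" and Q: "inverse_ops P Q"
  shows "1 \<le> norm Q"
proof -
  obtain x :: 'a where x: "norm x = 1" using unit by blast
  have "blinfun_apply Q (blinfun_apply P x) = x"
    using Q unfolding inverse_ops_def by (metis blinfun_apply_blinfun_compose id_blinfun.rep_eq id_apply)
  then have "1 \<le> norm Q * norm (blinfun_apply P x)" using norm_blinfun[of Q "blinfun_apply P x"] x by simp
  also have "\<dots> \<le> norm Q * 1"
    using norm_apply_le_of_contraction[OF P, of x] x by (intro mult_left_mono) auto
  finally show ?thesis by simp
qed

text \<open>
  A lower bound \<open>c \<parallel>x\<parallel>\<^sup>2 \<le> \<parallel>T x\<parallel>\<^sup>2\<close> gives an inverse of norm at most \<open>1 / c\<close>, and an inverse \<open>Q\<close> gives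
  this lower bound with \<open>c = 1 / \<parallel>Q\<parallel>\<close>. The constants match, so the two bounds determine the norm of
  the inverse.
\<close>

lemma gram_inverse_min_modulus:
  fixes T :: "'a::chilbert_space \<Rightarrow>\<^sub>L 'b::chilbert_space"
  assumes unit: "\<exists>x::'a. norm x = 1" and T: "clinear_op T" "norm T \<le> 1"
  shows "invertible_op (adj T o\<^sub>L T) \<longleftrightarrow> min_modulus T \<noteq> 0"
    and "invertible_op (adj T o\<^sub>L T) \<Longrightarrow>
      norm (inv_op (adj T o\<^sub>L T)) = inverse ((min_modulus T)\<^sup>2)"
proof -
  have pos: "0 < (min_modulus T)\<^sup>2 \<and> inverse (norm Q) \<le> (min_modulus T)\<^sup>2"
    if Q: "inverse_ops (adj T o\<^sub>L T) Q" for Q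
  proof -
    have ge: "1 \<le> norm Q"
      by (rule inverse_of_contraction_norm_ge[OF unit norm_gram_le[OF T] Q])
    have "0 < norm Q" using ge by linarith
    have "(norm x)\<^sup>2 / norm Q \<le> (norm (blinfun_apply T x))\<^sup>2" for x
      using gram_inverse_lower_bound[OF T(1) Q, of x] \<open>0 < norm Q\<close>
      by (simp only: pos_divide_le_eq mult.commute)
    then have "inverse (norm Q) * (norm x)\<^sup>2 \<le> (norm (blinfun_apply T x))\<^sup>2" for x
      by (metis divide_inverse mult.commute)
    then have "inverse (norm Q) \<le> (min_modulus T)\<^sup>2" by (simp add: min_modulus_sq_ge_iff[OF unit])
    moreover have "0 < inverse (norm Q)" using \<open>0 < norm Q\<close> by (rule positive_imp_inverse_positive)
    ultimately show ?thesis by linarith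
  qed
  have ex: "\<exists>Q. inverse_ops (adj T o\<^sub>L T) Q \<and> norm Q \<le> inverse ((min_modulus T)\<^sup>2)"
    if "min_modulus T \<noteq> 0"
  proof -
    have "0 < (min_modulus T)\<^sup>2" using that by simp
    moreover have "(min_modulus T)\<^sup>2 * (norm x)\<^sup>2 \<le> (norm (blinfun_apply T x))\<^sup>2" for x
      using min_modulus_sq_ge_iff[OF unit, of "(min_modulus T)\<^sup>2" T] by simp
    ultimately obtain Q where "inverse_ops (adj T o\<^sub>L T) Q" "norm Q \<le> inverse ((min_modulus T)\<^sup>2)"
      by (rule gram_invertible[OF T])
    then show ?thesis by blast
  qed
  show iff: "invertible_op (adj T o\<^sub>L T) \<longleftrightarrow> min_modulus T \<noteq> 0"
    using pos ex unfolding invertible_op_def by fastforce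
  assume "invertible_op (adj T o\<^sub>L T)"
  then obtain Q where Q: "inverse_ops (adj T o\<^sub>L T) Q" "norm Q \<le> inverse ((min_modulus T)\<^sup>2)"
    using iff ex by blast
  have "0 < norm Q" using inverse_of_contraction_norm_ge[OF unit norm_gram_le[OF T] Q(1)] by linarith
  then have "inverse ((min_modulus T)\<^sup>2) \<le> norm Q" using pos[OF Q(1)] by (simp add: field_simps)
  then show "norm (inv_op (adj T o\<^sub>L T)) = inverse ((min_modulus T)\<^sup>2)"
    using Q inv_op_eq by fastforce
qed

section \<open>The radial infimum property\<close>

text \<open>
  The minimum modulus is an infimum over unit vectors, which has a meaning only if there are some. A
  nonzero value of \<open>F\<close> provides a nonzero vector over \<open>'h\<close>, and the unitary moves it to the Fock space.
\<close>

lemma fock_tensor_unit_vector_exists: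
  fixes F :: "('n::countable \<Rightarrow> ('h::chilbert_space \<Rightarrow>\<^sub>L 'h)) \<Rightarrow>
      (('h, 'e::chilbert_space) htensor \<Rightarrow>\<^sub>L ('h, 'g::chilbert_space) htensor)"
    and U :: "'n fock \<Rightarrow>\<^sub>L 'h"
  assumes U: "unitary_pair U W" and F: "sup_norm F \<noteq> 0"
  shows "\<exists>x :: ('n fock, 'e) htensor. norm x = 1"
proof -
  have "row_ball \<noteq> ({} :: ('n \<Rightarrow> ('h \<Rightarrow>\<^sub>L 'h)) set)"
    using unitary_creation_row_ball[OF U, of "1/2"] by auto
  have "\<exists>X\<in>row_ball. F X \<noteq> 0"
  proof (rule ccontr)
    assume "\<not> (\<exists>X\<in>row_ball. F X \<noteq> 0)"
    then have "(\<lambda>X. norm (F X)) ` row_ball = {0}" using \<open>row_ball \<noteq> {}\<close> by auto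
    then show False using F by (simp add: sup_norm_def)
  qed
  then obtain X f where "blinfun_apply (F X) f \<noteq> 0" by (metis blinfun_eqI blinfun.zero_left)
  then have "f \<noteq> 0" by (auto simp: blinfun.zero_right)
  define g where "g = blinfun_apply (op_tensor W (id_blinfun :: 'e \<Rightarrow>\<^sub>L 'e)) f"
  have "norm g = norm f"
    unfolding g_def by (rule unitary_pair_norm[OF unitary_pair_tensor_id[OF unitary_pair_sym[OF U]]])
  then have "norm (inverse (norm g) *\<^sub>R g) = 1" using \<open>f \<noteq> 0\<close> by simp
  then show ?thesis by blast
qed

lemma eventually_at_left_1_iff:
  "(\<forall>\<^sub>F r in at_left (1::real). P r) \<longleftrightarrow> (\<exists>\<delta>\<in>{0<..<1}. \<forall>r\<in>{\<delta><..<1}. P r)"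
proof
  assume "\<forall>\<^sub>F r in at_left (1::real). P r"
  then obtain b where "b < 1" "\<And>r. b < r \<Longrightarrow> r < 1 \<Longrightarrow> P r"
    unfolding eventually_at_left_field by blast
  then show "\<exists>\<delta>\<in>{0<..<1}. \<forall>r\<in>{\<delta><..<1}. P r" by (intro bexI[of _ "max b (1/2)"]) auto
qed (auto simp: eventually_at_left_field)

theorem theorem3p2:
  fixes F :: "('n::countable \<Rightarrow> ('h::chilbert_space \<Rightarrow>\<^sub>L 'h)) \<Rightarrow>
      (('h, 'e::chilbert_space) htensor \<Rightarrow>\<^sub>L ('h, 'g::chilbert_space) htensor)"
    and A :: "'n list \<Rightarrow> ('e \<Rightarrow>\<^sub>L 'g)"
  assumes "\<exists>D::'h set. countable D \<and> closure D = UNIV"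
    and "\<nexists>B::'h set. finite B \<and> span B = UNIV"
    and "free_holomorphic F A"
    and "bounded (F ` row_ball)"
    and "sup_norm F = 1"
  shows
    "(radial_infimum_property F A \<longleftrightarrow>
        ((\<lambda>r. min_modulus (eval_radial A r)) \<longlongrightarrow> 1) (at_left 1)) \<and>
     (radial_infimum_property F A \<longleftrightarrow>
        (\<forall>\<epsilon>\<in>{0<..<1::real}. \<exists>\<delta>\<in>{0<..<1::real}. \<forall>r\<in>{\<delta><..<1}.
           op_ge (adj (eval_radial A r) o\<^sub>L eval_radial A r) ((1 - \<epsilon>) *\<^sub>R id_blinfun))) \<and>
     (radial_infimum_property F A \<longleftrightarrow>
        (\<exists>c::real \<Rightarrow> real. (\<forall>r\<in>{0<..<1}. c r \<in> {0<..1}) \<and> (c \<longlongrightarrow> 1) (at_left 1) \<and>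
           (\<forall>\<^sub>F r in at_left 1.
              op_ge (adj (eval_radial A r) o\<^sub>L eval_radial A r) (c r *\<^sub>R id_blinfun)))) \<and>
     (radial_infimum_property F A \<longleftrightarrow>
        (\<exists>\<delta>\<in>{0<..<1::real}. \<forall>r\<in>{\<delta><..<1}.
           invertible_op (adj (eval_radial A r) o\<^sub>L eval_radial A r)) \<and>
        ((\<lambda>r. norm (inv_op (adj (eval_radial A r) o\<^sub>L eval_radial A r))) \<longlongrightarrow> 1) (at_left 1))"
proof -
  obtain U :: "'n fock \<Rightarrow>\<^sub>L 'h" and W where U: "unitary_pair U W"
    by (rule fock_unitary_exists[OF assms(1,2)])
  define T where "T = eval_radial A"
  define s where "s r = (min_modulus (T r))\<^sup>2" for r
  have unit: "\<exists>x :: ('n fock, 'e) htensor. norm x = 1"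
    by (rule fock_tensor_unit_vector_exists[OF U, of F]) (simp add: assms(5))
  have T: "clinear_op (T r)" "norm (T r) \<le> 1" if "0 < r" "r < 1" for r
    using eval_radial_bounded[OF U assms(3,4) that] by (simp_all add: T_def assms(5))
  have m: "0 \<le> min_modulus (T r)" "min_modulus (T r) \<le> 1" if "0 < r" "r < 1" for r
    using min_modulus_bounds[OF unit T(2)[OF that]] by auto
  have near: "\<forall>\<^sub>F r in at_left (1::real). 0 < r \<and> r < 1"
    unfolding eventually_at_left_1_iff by (intro bexI[of _ "1/2"]) auto
  have s_le: "\<forall>\<^sub>F r in at_left 1. s r \<le> 1"
    using near by eventually_elim (simp add: s_def m power_le_one)
  have op_ge_iff: "op_ge (adj (T r) o\<^sub>L T r) (c *\<^sub>R id_blinfun) \<longleftrightarrow> c \<le> s r" if "0 < r" "r < 1" for r c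
    unfolding s_def by (simp add: op_ge_gram_iff[OF T(1)[OF that]] min_modulus_sq_ge_iff[OF unit])
  have m_lim: "((\<lambda>r. min_modulus (T r)) \<longlongrightarrow> 1) (at_left 1) \<longleftrightarrow> (s \<longlongrightarrow> 1) (at_left 1)"
  proof
    assume "((\<lambda>r. min_modulus (T r)) \<longlongrightarrow> 1) (at_left 1)"
    then show "(s \<longlongrightarrow> 1) (at_left 1)" unfolding s_def using tendsto_power[of _ 1 _ 2] by fastforce
  next
    assume "(s \<longlongrightarrow> 1) (at_left 1)"
    then have "((\<lambda>r. sqrt (s r)) \<longlongrightarrow> 1) (at_left 1)" using tendsto_real_sqrt[of s 1] by simp
    then show "((\<lambda>r. min_modulus (T r)) \<longlongrightarrow> 1) (at_left 1)"
      by (rule Lim_transform_eventually) (use near in eventually_elim, simp add: s_def m)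
  qed
  have i: "radial_infimum_property F A \<longleftrightarrow> (s \<longlongrightarrow> 1) (at_left 1)"
  proof -
    let ?f = "\<lambda>r. ereal (min_modulus (T r))"
    have "Limsup (at_left 1) ?f \<le> 1"
      by (rule Limsup_bounded) (use near in eventually_elim, simp add: m)
    moreover have "Liminf (at_left 1) ?f \<le> Limsup (at_left 1) ?f" by (rule Liminf_le_Limsup) simp
    ultimately have "Liminf (at_left 1) ?f = 1 \<longleftrightarrow> (?f \<longlongrightarrow> 1) (at_left 1)"
      by (subst tendsto_iff_Liminf_eq_Limsup) auto
    then show ?thesis
      unfolding radial_infimum_property_def assms(5) m_lim[symmetric] T_def
      by (simp add: one_ereal_def)
  qed
  have iii: "(s \<longlongrightarrow> 1) (at_left 1) \<longleftrightarrow> (\<forall>\<epsilon>\<in>{0<..<1::real}. \<exists>\<delta>\<in>{0<..<1::real}. \<forall>r\<in>{\<delta><..<1}.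
      op_ge (adj (T r) o\<^sub>L T r) ((1 - \<epsilon>) *\<^sub>R id_blinfun))" (is "_ \<longleftrightarrow> ?iii")
  proof
    assume lim: "(s \<longlongrightarrow> 1) (at_left 1)"
    show ?iii
    proof
      fix \<epsilon> :: real assume "\<epsilon> \<in> {0<..<1}"
      then have "\<forall>\<^sub>F r in at_left 1. 1 - \<epsilon> < s r" by (intro order_tendstoD(1)[OF lim]) auto
      then have "\<forall>\<^sub>F r in at_left 1. op_ge (adj (T r) o\<^sub>L T r) ((1 - \<epsilon>) *\<^sub>R id_blinfun)"
        using near by eventually_elim (simp add: op_ge_iff)
      then show "\<exists>\<delta>\<in>{0<..<1::real}. \<forall>r\<in>{\<delta><..<1}. op_ge (adj (T r) o\<^sub>L T r) ((1 - \<epsilon>) *\<^sub>R id_blinfun)"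
        unfolding eventually_at_left_1_iff .
    qed
  next
    assume iii: ?iii
    show "(s \<longlongrightarrow> 1) (at_left 1)"
    proof (rule order_tendstoI)
      fix a :: real assume "a < 1"
      define \<epsilon> where "\<epsilon> = min ((1 - a) / 2) (1/2)"
      have \<epsilon>: "\<epsilon> \<in> {0<..<1}" "a < 1 - \<epsilon>"
        using \<open>a < 1\<close> min.cobounded1[of "(1 - a) / 2" "1/2"] min.cobounded2[of "(1 - a) / 2" "1/2"]
        by (simp_all add: \<epsilon>_def field_simps)
      then have "\<forall>\<^sub>F r in at_left 1. op_ge (adj (T r) o\<^sub>L T r) ((1 - \<epsilon>) *\<^sub>R id_blinfun)"
        using iii unfolding eventually_at_left_1_iff by blast
      then show "\<forall>\<^sub>F r in at_left 1. a < s r"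
        using near by eventually_elim (use \<epsilon>(2) in \<open>simp add: op_ge_iff\<close>)
    next
      fix a :: real assume "1 < a"
      show "\<forall>\<^sub>F r in at_left 1. s r < a" using s_le by eventually_elim (use \<open>1 < a\<close> in simp)
    qed
  qed
  have iv: "(s \<longlongrightarrow> 1) (at_left 1) \<longleftrightarrow>
    (\<exists>c::real \<Rightarrow> real. (\<forall>r\<in>{0<..<1}. c r \<in> {0<..1}) \<and> (c \<longlongrightarrow> 1) (at_left 1) \<and>
       (\<forall>\<^sub>F r in at_left 1. op_ge (adj (T r) o\<^sub>L T r) (c r *\<^sub>R id_blinfun)))" (is "_ \<longleftrightarrow> ?iv")
  proof
    assume lim: "(s \<longlongrightarrow> 1) (at_left 1)"
    \<comment> \<open>\<open>s r\<close> may vanish for \<open>r\<close> away from \<open>1\<close>; there any value in \<open>(0, 1]\<close> will do.\<close>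
    define c where "c r = (if s r = 0 then 1 else s r)" for r
    have pos: "\<forall>\<^sub>F r in at_left 1. 0 < s r" by (rule order_tendstoD(1)[OF lim]) simp
    have "(c \<longlongrightarrow> 1) (at_left 1)"
      by (rule Lim_transform_eventually[OF lim]) (use pos in eventually_elim, simp add: c_def)
    moreover have "\<forall>\<^sub>F r in at_left 1. op_ge (adj (T r) o\<^sub>L T r) (c r *\<^sub>R id_blinfun)"
      using pos near by eventually_elim (simp add: op_ge_iff c_def)
    moreover have "c r \<in> {0<..1}" if "r \<in> {0<..<1}" for r
      using m[of r] that by (auto simp: c_def s_def power_le_one)
    ultimately show ?iv by blast
  next
    assume ?iv
    then obtain c where c: "(c \<longlongrightarrow> 1) (at_left 1)"
      "\<forall>\<^sub>F r in at_left 1. op_ge (adj (T r) o\<^sub>L T r) (c r *\<^sub>R id_blinfun)" by blast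
    have "\<forall>\<^sub>F r in at_left 1. c r \<le> s r" using c(2) near by eventually_elim (simp add: op_ge_iff)
    then show "(s \<longlongrightarrow> 1) (at_left 1)" by (rule tendsto_sandwich[OF _ s_le c(1) tendsto_const])
  qed
  have inv: "\<forall>\<^sub>F r in at_left 1. invertible_op (adj (T r) o\<^sub>L T r) \<longleftrightarrow> s r \<noteq> 0"
    "\<forall>\<^sub>F r in at_left 1. invertible_op (adj (T r) o\<^sub>L T r) \<longrightarrow> norm (inv_op (adj (T r) o\<^sub>L T r)) = inverse (s r)"
    using near by (eventually_elim, simp add: s_def gram_inverse_min_modulus[OF unit T])+
  have v: "(s \<longlongrightarrow> 1) (at_left 1) \<longleftrightarrow>
    (\<exists>\<delta>\<in>{0<..<1::real}. \<forall>r\<in>{\<delta><..<1}. invertible_op (adj (T r) o\<^sub>L T r)) \<and>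
    ((\<lambda>r. norm (inv_op (adj (T r) o\<^sub>L T r))) \<longlongrightarrow> 1) (at_left 1)"
    unfolding eventually_at_left_1_iff[symmetric]
  proof
    assume lim: "(s \<longlongrightarrow> 1) (at_left 1)"
    have "\<forall>\<^sub>F r in at_left 1. 0 < s r" by (rule order_tendstoD(1)[OF lim]) simp
    then have "\<forall>\<^sub>F r in at_left 1. invertible_op (adj (T r) o\<^sub>L T r)"
      using inv(1) by eventually_elim simp
    moreover from this have "\<forall>\<^sub>F r in at_left 1. inverse (s r) = norm (inv_op (adj (T r) o\<^sub>L T r))"
      using inv(2) by eventually_elim simp
    then have "((\<lambda>r. norm (inv_op (adj (T r) o\<^sub>L T r))) \<longlongrightarrow> 1) (at_left 1)"
      using tendsto_inverse[OF lim] by (simp add: Lim_transform_eventually)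
    ultimately show "(\<forall>\<^sub>F r in at_left 1. invertible_op (adj (T r) o\<^sub>L T r)) \<and>
      ((\<lambda>r. norm (inv_op (adj (T r) o\<^sub>L T r))) \<longlongrightarrow> 1) (at_left 1)" ..
  next
    assume v: "(\<forall>\<^sub>F r in at_left 1. invertible_op (adj (T r) o\<^sub>L T r)) \<and>
      ((\<lambda>r. norm (inv_op (adj (T r) o\<^sub>L T r))) \<longlongrightarrow> 1) (at_left 1)"
    then have "\<forall>\<^sub>F r in at_left 1. invertible_op (adj (T r) o\<^sub>L T r)" ..
    then have "\<forall>\<^sub>F r in at_left 1. inverse (norm (inv_op (adj (T r) o\<^sub>L T r))) = s r"
      using inv(2) by eventually_elim simp
    then show "(s \<longlongrightarrow> 1) (at_left 1)"
      using tendsto_inverse[OF conjunct2[OF v]] by (simp add: Lim_transform_eventually)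
  qed
  show ?thesis
    using i m_lim iii iv v unfolding T_def by (simp only: simp_thms)
qed

end
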